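(* Consider Cantor space $2^{\mathbb N}$ with the Lebesgue measure $\lambda$. Then the following are equivalent for a point $x\in 2^{\mathbb N}$: (a) $x$ is Kurtz random. (b) For every clopen set $A\ni x$ with $\lambda(A)>0$ and every computable measure-preserving transformation $T:\subseteq 2^{\mathbb N}\to 2^{\mathbb N}$ with $x\in\operatorname{dom}T$, we have $T^k(x)\in A$ for some $k>0$. (c) For every clopen set $A$ with $\lambda(A)>0$ and every computable ergodic measure-preserving transformation $T:\subseteq 2^{\mathbb N}\to 2^{\mathbb N}$ with $x\in\operatorname{dom}T$, we have $T^k(x)\in A$ for some $k>0$. (d) For every clopen set $A\ni x$ with $\lambda(A)>0$ and every computable ergodic measure-preserving transformation $T:\subseteq 2^{\mathbb N}\to 2^{\mathbb N}$ with $x\in\operatorname{dom}T$, we have $T^k(x)\in A$ for some $k>0$.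
   Context: For a finite binary string $\sigma$, $[\![\sigma]\!]=\{x\in 2^{\mathbb N}:\sigma\text{ is an initial segment of }x\}$; these cylinders are the basic open sets of Cantor space. The Lebesgue measure $\lambda$ is the Borel probability measure with $\lambda[\![\sigma]\!]=2^{-|\sigma|}$. A set is $\Sigma^0_1$ if it is $\bigcup_{\sigma\in W}[\![\sigma]\!]$ for a c.e. set $W$ of strings, and $\Pi^0_1$ if its complement is $\Sigma^0_1$. A point is Kurtz random if it lies in no $\lambda$-null $\Pi^0_1$ set. A measure-preserving transformation is a partial Borel measurable map $T:\subseteq 2^{\mathbb N}\to 2^{\mathbb N}$ such that $\lambda(T^{-1}(B))=\lambda(B)$ for every Borel $B$ (so $\operatorname{dom}T$ has full measure) and $x\in\operatorname{dom}T$ implies $T(x)\in\operatorname{dom}T$. It is computable if, uniformly in $\sigma$, $T^{-1}[\![\sigma]\!]$ is the intersection of $\operatorname{dom}T$ with a $\Sigma^0_1$ set. It is ergodic if every Borel $B$ with $T^{-1}(B)=B$ has measure $0$ or $1$. *)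

theory Defs
  imports "HOL-Probability.Probability" "HOL-Library.Nat_Bijection"
begin
text \<open>
  Codes for the partial recursive functions; \<open>computes f xs y\<close> says that \<open>f\<close> halts on \<open>xs\<close> with
  value \<open>y\<close>. Arities are not tracked: a code denotes a partial function on lists of every length.
  The recursion and minimization argument is the first one.
\<close>

datatype recf =
    Zero
  | Succ
  | Proj nat
  | Comp recf "recf list"
  | PrimRec recf recf
  | Mu recf

inductive computes :: "recf \<Rightarrow> nat list \<Rightarrow> nat \<Rightarrow> bool" where
  Zero: "computes Zero xs 0"
| Succ: "computes Succ (x # xs) (Suc x)"
| Proj: "i < length xs \<Longrightarrow> computes (Proj i) xs (xs ! i)"
| Comp: "list_all2 (\<lambda>g y. computes g xs y) gs ys \<Longrightarrow> computes f ys z \<Longrightarrow> computes (Comp f gs) xs z"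
| PrimRec_0: "computes f xs y \<Longrightarrow> computes (PrimRec f g) (0 # xs) y"
| PrimRec_Suc: "computes (PrimRec f g) (n # xs) r \<Longrightarrow> computes g (n # r # xs) y \<Longrightarrow>
    computes (PrimRec f g) (Suc n # xs) y"
| Mu: "computes f (n # xs) 0 \<Longrightarrow> (\<And>m. m < n \<Longrightarrow> \<exists>k. k > 0 \<and> computes f (m # xs) k) \<Longrightarrow>
    computes (Mu f) xs n"

definition ce :: "nat set \<Rightarrow> bool" where
  "ce S \<longleftrightarrow> (\<exists>f. S = {n. \<exists>y. computes f [n] y})"

definition string_code :: "bool list \<Rightarrow> nat" where
  "string_code \<sigma> = list_encode (map of_bool \<sigma>)"

definition ce_strings :: "bool list set \<Rightarrow> bool" where
  "ce_strings W \<longleftrightarrow> ce (string_code ` W)"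

definition ce_string_pairs :: "(bool list \<times> bool list) set \<Rightarrow> bool" where
  "ce_string_pairs W \<longleftrightarrow> ce ((\<lambda>(\<sigma>, \<tau>). prod_encode (string_code \<sigma>, string_code \<tau>)) ` W)"

text \<open>
  Points of Cantor space are functions \<open>nat \<Rightarrow> bool\<close>; the library's topology on this type is the
  product of the discrete topologies.
\<close>

type_synonym cantor = "nat \<Rightarrow> bool"

definition cylinder :: "bool list \<Rightarrow> cantor set" where
  "cylinder \<sigma> = {x. \<forall>i<length \<sigma>. x i = \<sigma> ! i}"

definition cantor_measure :: "cantor measure" where
  "cantor_measure = PiM UNIV (\<lambda>_. measure_pmf (bernoulli_pmf (1/2)))"

definition Sigma01 :: "cantor set \<Rightarrow> bool" where
  "Sigma01 U \<longleftrightarrow> (\<exists>W. ce_strings W \<and> U = (\<Union>\<sigma>\<in>W. cylinder \<sigma>))"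

definition Pi01 :: "cantor set \<Rightarrow> bool" where
  "Pi01 P \<longleftrightarrow> Sigma01 (- P)"

definition kurtz_random :: "cantor \<Rightarrow> bool" where
  "kurtz_random x \<longleftrightarrow> \<not> (\<exists>P. Pi01 P \<and> P \<in> null_sets cantor_measure \<and> x \<in> P)"

definition clopen :: "cantor set \<Rightarrow> bool" where
  "clopen A \<longleftrightarrow> open A \<and> closed A"

definition preimage :: "('a \<rightharpoonup> 'b) \<Rightarrow> 'b set \<Rightarrow> 'a set" where
  "preimage T B = {x. \<exists>y\<in>B. T x = Some y}"

definition iterate :: "('a \<rightharpoonup> 'a) \<Rightarrow> nat \<Rightarrow> 'a \<rightharpoonup> 'a" where
  "iterate T k x = ((\<lambda>z. Option.bind z T) ^^ k) (Some x)"

definition measure_preserving_transformation :: "(cantor \<rightharpoonup> cantor) \<Rightarrow> bool" where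
  "measure_preserving_transformation T \<longleftrightarrow>
     (\<forall>B\<in>sets borel. preimage T B \<in> sets borel) \<and>
     (\<forall>B\<in>sets borel. emeasure cantor_measure (preimage T B) = emeasure cantor_measure B) \<and>
     (\<forall>x y. T x = Some y \<longrightarrow> y \<in> dom T)"

text \<open>
  Uniformity in \<open>\<sigma>\<close>: the c.e. sets of strings generating the preimages of the cylinders are the
  sections of a single c.e. set of pairs.
\<close>

definition computable_transformation :: "(cantor \<rightharpoonup> cantor) \<Rightarrow> bool" where
  "computable_transformation T \<longleftrightarrow>
     (\<exists>W. ce_string_pairs W \<and>
       (\<forall>\<sigma>. preimage T (cylinder \<sigma>) = dom T \<inter> (\<Union>\<tau>\<in>{\<tau>. (\<sigma>, \<tau>) \<in> W}. cylinder \<tau>)))"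

definition ergodic :: "(cantor \<rightharpoonup> cantor) \<Rightarrow> bool" where
  "ergodic T \<longleftrightarrow>
     (\<forall>B\<in>sets borel. preimage T B = B \<longrightarrow>
        emeasure cantor_measure B = 0 \<or> emeasure cantor_measure B = 1)"

lemma open_cylinder: "open (cylinder \<sigma>)"
proof -
  have "cylinder \<sigma> = {x. \<forall>i\<in>{..<length \<sigma>}. x (id i) \<in> {\<sigma> ! i}}"
    by (auto simp: cylinder_def)
  moreover have "open {x::cantor. \<forall>i\<in>{..<length \<sigma>}. x (id i) \<in> {\<sigma> ! i}}"
    by (rule product_topology_basis') (auto intro: Topological_Spaces.open_discrete)
  ultimately show ?thesis
    by simp
qed

lemma open_iff_cylinders: "open U \<longleftrightarrow> (\<exists>W. U = (\<Union>\<sigma>\<in>W. cylinder \<sigma>))"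
proof
  assume U: "open U"
  have "\<exists>\<sigma>. x \<in> cylinder \<sigma> \<and> cylinder \<sigma> \<subseteq> U" if "x \<in> U" for x
  proof -
    from U have "openin (product_topology (\<lambda>i. euclidean) UNIV) U"
      by (simp add: open_fun_def)
    from product_topology_open_contains_basis[OF this that] obtain X where
      X: "x \<in> (\<Pi>\<^sub>E i\<in>UNIV. X i)" "finite {i. X i \<noteq> UNIV}" "(\<Pi>\<^sub>E i\<in>UNIV. X i) \<subseteq> U"
      by auto
    obtain n where n: "\<forall>i\<in>{i. X i \<noteq> UNIV}. i < n"
      using X(2) unfolding finite_nat_set_iff_bounded by blast
    have xX: "x i \<in> X i" for i
      using X(1) by (rule PiE_mem) simp
    have "y i \<in> X i" if "y \<in> cylinder (map x [0..<n])" for y i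
    proof (cases "i < n")
      case True
      then have "y i = x i" using that by (simp add: cylinder_def)
      then show ?thesis using xX[of i] by simp
    next
      case False
      then have "X i = UNIV" using n by blast
      then show ?thesis by simp
    qed
    then have "y \<in> (\<Pi>\<^sub>E i\<in>UNIV. X i)" if "y \<in> cylinder (map x [0..<n])" for y
      using that by (intro PiE_I) auto
    with X(3) have "cylinder (map x [0..<n]) \<subseteq> U"
      by (meson subset_iff)
    moreover have "x \<in> cylinder (map x [0..<n])"
      by (simp add: cylinder_def)
    ultimately show ?thesis by blast
  qed
  then have "U = (\<Union>\<sigma>\<in>{\<sigma>. cylinder \<sigma> \<subseteq> U}. cylinder \<sigma>)"
    by blast
  then show "\<exists>W. U = (\<Union>\<sigma>\<in>W. cylinder \<sigma>)" ..
qed (auto intro: open_cylinder)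

lemma cylinder_eq_prod_emb:
  "cylinder \<sigma> = prod_emb UNIV (\<lambda>_. measure_pmf (bernoulli_pmf (1/2))) {..<length \<sigma>}
     (\<Pi>\<^sub>E i\<in>{..<length \<sigma>}. {\<sigma> ! i})"
  by (auto simp: cylinder_def prod_emb_def PiE_def Pi_def extensional_def)

lemma emeasure_cylinder: "emeasure cantor_measure (cylinder \<sigma>) = ennreal ((1/2) ^ length \<sigma>)"
proof -
  interpret product_prob_space "\<lambda>_::nat. measure_pmf (bernoulli_pmf (1/2))" UNIV ..
  have *: "pmf (bernoulli_pmf (1/2)) b = 1/2" for b
    by (cases b) auto
  have "emeasure cantor_measure (cylinder \<sigma>) =
      (\<Prod>i<length \<sigma>. emeasure (measure_pmf (bernoulli_pmf (1/2))) {\<sigma> ! i})"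
    unfolding cantor_measure_def cylinder_eq_prod_emb by (rule emeasure_PiM_emb) auto
  also have "\<dots> = (\<Prod>i<length \<sigma>. ennreal (1/2))"
    by (simp only: emeasure_pmf_single *)
  also have "\<dots> = ennreal ((1/2) ^ length \<sigma>)"
    by (simp only: prod_constant card_lessThan) (rule ennreal_power, simp)
  finally show ?thesis .
qed

lemma prob_space_cantor_measure: "prob_space cantor_measure"
  unfolding cantor_measure_def by (intro prob_space_PiM prob_space_measure_pmf)

lemma sets_cantor_measure: "sets cantor_measure = sets borel"
proof
  let ?M = "\<lambda>_::nat. measure_pmf (bernoulli_pmf (1/2))"
  have cyl: "cylinder \<sigma> \<in> sets cantor_measure" for \<sigma>
    unfolding cantor_measure_def cylinder_eq_prod_emb by (rule sets_PiM_I) auto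
  have "U \<in> sets cantor_measure" if "open U" for U
  proof -
    from that obtain W where "U = (\<Union>\<sigma>\<in>W. cylinder \<sigma>)"
      by (auto simp only: open_iff_cylinders)
    moreover have "(\<Union>\<sigma>\<in>W. cylinder \<sigma>) \<in> sets cantor_measure"
      by (rule sets.countable_UN'') (auto simp: cyl)
    ultimately show ?thesis by simp
  qed
  moreover have "space cantor_measure = UNIV"
    by (simp add: cantor_measure_def space_PiM)
  ultimately have "sigma_sets UNIV {U. open U} \<subseteq> sets cantor_measure"
    using sets.sigma_sets_subset[of "{U. open U}" cantor_measure] by (simp add: subset_iff)
  then show "sets borel \<subseteq> sets cantor_measure"
    by (simp add: sets_borel)
  have "{f. f i \<in> A} \<in> sets borel" for i :: nat and A :: "bool set"
  proof -
    have "open {f::cantor. \<forall>j\<in>{i}. f (id j) \<in> A}"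
      by (rule product_topology_basis') (auto intro: Topological_Spaces.open_discrete)
    then show ?thesis by simp
  qed
  then have "sigma_sets UNIV {{f. f i \<in> A} |i A. True} \<subseteq> sets (borel :: cantor measure)"
    using sets.sigma_sets_subset[of "{{f. f i \<in> A} |i A. True}" "borel :: cantor measure"]
    by fastforce
  then have "sets (PiM UNIV ?M) \<subseteq> sets borel"
    by (simp add: sets_PiM_single)
  then show "sets cantor_measure \<subseteq> sets borel"
    by (simp add: cantor_measure_def)
qed

end

theory Submission
  imports Defs
begin

text \<open>
  If \<open>x\<close> is Kurtz random, let \<open>R\<close> be the set of points that return to \<open>A\<close>. Computability of \<open>T\<close> makes \<open>R\<close> the
  trace on \<open>dom T\<close> of a \<open>\<Sigma>\<^sup>0\<^sub>1\<close> set \<open>V\<close>; by Poincare recurrence \<open>A - V\<close> is a null \<open>\<Pi>\<^sup>0\<^sub>1\<close> set, and if \<open>T\<close> is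
  ergodic then \<open>- V\<close> is one. So \<open>x \<in> V\<close>.

  Conversely let \<open>x\<close> lie in a null \<open>\<Pi>\<^sup>0\<^sub>1\<close> set \<open>P\<close> and let \<open>c\<close> be the bit opposite to \<open>x 0\<close>. Enumerate the
  complement of \<open>P\<close> in \<open>cylinder [\<not> c]\<close> as a disjoint union of cylinders, and pair these with cylinders of
  the same lengths that exhaust \<open>cylinder [\<not> c]\<close> except for the point \<open>q = (\<not> c) c c c ...\<close>. Exchanging the
  paired cylinders and sending \<open>x\<close> to \<open>q\<close> gives a measure-preserving bijection \<open>\<phi>\<close> up to null sets, and the
  conjugate of the shift by \<open>\<phi>\<close> is ergodic and takes \<open>x\<close> to the fixed point \<open>c c c ...\<close>, outside of
  \<open>cylinder [\<not> c]\<close>. It is computable because every neighbourhood of \<open>x\<close> that is still undecided at stage \<open>m\<close>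
  is mapped into the part of \<open>cylinder [\<not> c]\<close> not yet allotted at stage \<open>m\<close>, which shrinks to \<open>q\<close>.
\<close>

section \<open>Computable functions\<close>

text \<open>The obstacle in the converse is that \<open>x\<close> may be noncomputable, while
  \<open>T\<close> must be computable and still have \<open>x\<close> in its domain, so the
  algorithm may not consult \<open>x\<close> beyond its first bit. Hence \<phi> treats all undecided
  points alike and sends every point of \<open>P\<close> in \<open>cylinder [\<not> c]\<close> to
  \<open>q\<close>. The point \<open>x\<close> enters only as the value of the inverse \<psi> at
  \<open>q\<close>, and the domain condition \<open>\<psi> (\<phi> y) = y\<close> discards the other
  points of \<open>P\<close>. Points whose orbit would meet \<open>q\<close> at a positive time are
  excluded as well, because there \<psi> would have to output \<open>x\<close>. Cylinders of the
  same lengths are available because at every stage as many targets are kept as sources are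
  undecided. Since \<open>P\<close> is null, the remaining targets are eventually few, and a stage
  at which they are close enough to \<open>q\<close> is found by unbounded search. As the avoided
  set contains \<open>x\<close> and the conjugate is ergodic, one transformation refutes (b), (c)
  and (d) together. All algorithms are verified through closure properties of
  \<open>computable\<close> and \<open>semidec\<close>, which are tied to the recursive codes of the
  statement.\<close>

definition rfun :: "nat \<Rightarrow> (nat list \<Rightarrow> nat) \<Rightarrow> bool" where
  "rfun k f \<longleftrightarrow> (\<exists>c. \<forall>xs. length xs = k \<longrightarrow> computes c xs (f xs))"

lemma rfun_cong: "rfun k f \<Longrightarrow> (\<And>xs. length xs = k \<Longrightarrow> f xs = g xs) \<Longrightarrow> rfun k g"
  unfolding rfun_def by metis

lemma rfun_zero: "rfun k (\<lambda>_. 0)"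
  unfolding rfun_def using computes.Zero by blast

lemma rfun_proj: "i < k \<Longrightarrow> rfun k (\<lambda>xs. xs ! i)"
  unfolding rfun_def using computes.Proj by blast

lemma rfun_Suc: assumes "rfun k f" shows "rfun k (\<lambda>xs. Suc (f xs))"
proof -
  obtain c where "\<forall>xs. length xs = k \<longrightarrow> computes c xs (f xs)"
    using assms unfolding rfun_def by blast
  then have "\<forall>xs. length xs = k \<longrightarrow> computes (Comp Succ [c]) xs (Suc (f xs))"
    by (auto intro!: computes.Comp[where ys="[f _]"] computes.Succ)
  then show ?thesis unfolding rfun_def by blast
qed

lemma rfun_const: "rfun k (\<lambda>_. n)"
  by (induction n) (auto intro: rfun_zero rfun_Suc)

lemma rfun_comp:
  assumes "rfun (length gs) f" and gs: "\<forall>g\<in>set gs. rfun k g"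
  shows "rfun k (\<lambda>xs. f (map (\<lambda>g. g xs) gs))"
proof -
  obtain c where c: "\<forall>xs. length xs = length gs \<longrightarrow> computes c xs (f xs)"
    using assms unfolding rfun_def by blast
  have "\<exists>cs. \<forall>xs. length xs = k \<longrightarrow> list_all2 (\<lambda>c y. computes c xs y) cs (map (\<lambda>g. g xs) gs)"
    using gs
  proof (induction gs)
    case (Cons g gs)
    then obtain cs where "\<forall>xs. length xs = k \<longrightarrow> list_all2 (\<lambda>c y. computes c xs y) cs (map (\<lambda>g. g xs) gs)"
      by auto
    moreover from Cons.prems obtain d where "\<forall>xs. length xs = k \<longrightarrow> computes d xs (g xs)"
      unfolding rfun_def by auto
    ultimately show ?case by (intro exI[of _ "d # cs"]) auto
  qed auto
  then obtain cs where "\<forall>xs. length xs = k \<longrightarrow> list_all2 (\<lambda>c y. computes c xs y) cs (map (\<lambda>g. g xs) gs)"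
    by blast
  with c have "\<forall>xs. length xs = k \<longrightarrow> computes (Comp c cs) xs (f (map (\<lambda>g. g xs) gs))"
    by (auto intro: computes.Comp)
  then show ?thesis unfolding rfun_def by blast
qed

lemma rfun_comp1: "rfun 1 (\<lambda>xs. f (xs ! 0)) \<Longrightarrow> rfun k g \<Longrightarrow> rfun k (\<lambda>xs. f (g xs))"
  using rfun_comp[of "[g]" "\<lambda>xs. f (xs ! 0)" k] by simp

lemma map_proj_upt: "length xs = k + m \<Longrightarrow> map (\<lambda>g. g xs) (map (\<lambda>i xs. xs ! i) [m..<k + m]) = drop m xs"
  by (rule nth_equalityI) auto

text \<open>Lets a function of the parameters alone serve as a recursion step, whose arguments begin
  with the counter and the previous value.\<close>

lemma rfun_drop: "rfun k f \<Longrightarrow> rfun (k + m) (\<lambda>xs. f (drop m xs))"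
  by (rule rfun_cong[OF rfun_comp[of "map (\<lambda>i xs. xs ! i) [m..<k + m]" f]])
    (auto simp: map_proj_upt[unfolded map_map] rfun_proj)

lemma rfun_rec_hd:
  assumes "rfun k f" "rfun (Suc (Suc k)) g"
  shows "rfun (Suc k) (\<lambda>xs. rec_nat (f (tl xs)) (\<lambda>n r. g (n # r # tl xs)) (hd xs))"
proof -
  obtain c d where c: "\<forall>xs. length xs = k \<longrightarrow> computes c xs (f xs)"
    and d: "\<forall>xs. length xs = Suc (Suc k) \<longrightarrow> computes d xs (g xs)"
    using assms unfolding rfun_def by blast
  have "computes (PrimRec c d) (n # xs) (rec_nat (f xs) (\<lambda>n r. g (n # r # xs)) n)"
    if "length xs = k" for n xs
    using that by (induction n) (auto intro: computes.PrimRec_0 computes.PrimRec_Suc simp: c d)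
  then have "\<forall>xs. length xs = Suc k \<longrightarrow>
      computes (PrimRec c d) xs (rec_nat (f (tl xs)) (\<lambda>n r. g (n # r # tl xs)) (hd xs))"
    by (auto simp: length_Suc_conv)
  then show ?thesis unfolding rfun_def by blast
qed

text \<open>Prepending the computed bound \<open>h\<close> to a copy of all arguments reduces this
  to \<open>rfun_rec_hd\<close>, while every argument stays available as a parameter.\<close>

lemma rfun_rec:
  assumes f: "rfun k f" and g: "rfun (Suc (Suc k)) (\<lambda>ys. g (ys ! 0) (ys ! 1) (drop 2 ys))" and h: "rfun k h"
  shows "rfun k (\<lambda>xs. rec_nat (f xs) (\<lambda>n r. g n r xs) (h xs))"
proof -
  have len: "length (h # map (\<lambda>i xs. xs ! i) [0..<k]) = Suc k" by simp
  have "rfun k (\<lambda>xs. (\<lambda>xs. rec_nat (f (tl xs)) (\<lambda>n r. g n r (tl xs)) (hd xs))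
      (map (\<lambda>g. g xs) (h # map (\<lambda>i xs. xs ! i) [0..<k])))"
    using rfun_rec_hd[OF f g] h
    by (intro rfun_comp[unfolded len]) (auto simp: len intro: rfun_proj)
  then show ?thesis
    by (rule rfun_cong) (simp del: map_map add: map_proj_upt[of _ k 0, unfolded add_0_right drop_0])
qed

lemma rfun_add: assumes "rfun k f" "rfun k g" shows "rfun k (\<lambda>xs. f xs + g xs)"
proof -
  have "rfun k (\<lambda>xs. rec_nat (g xs) (\<lambda>n r. Suc r) (f xs))"
    by (rule rfun_rec) (auto intro: rfun_Suc rfun_proj assms)
  moreover have "rec_nat b (\<lambda>n r. Suc r) a = a + b" for a b by (induction a) auto
  ultimately show ?thesis by simp
qed

lemma rfun_pred: assumes "rfun k f" shows "rfun k (\<lambda>xs. f xs - 1)"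
proof -
  have "rfun k (\<lambda>xs. rec_nat 0 (\<lambda>n r. n) (f xs))"
    by (rule rfun_rec) (auto intro: rfun_zero rfun_proj assms)
  moreover have "rec_nat 0 (\<lambda>n r. n) a = a - 1" for a by (cases a) auto
  ultimately show ?thesis by simp
qed

lemma rfun_diff: assumes "rfun k f" "rfun k g" shows "rfun k (\<lambda>xs. f xs - g xs)"
proof -
  have "rfun k (\<lambda>xs. rec_nat (f xs) (\<lambda>n r. r - 1) (g xs))"
    by (rule rfun_rec) (auto intro: rfun_pred[unfolded One_nat_def] rfun_proj assms)
  moreover have "rec_nat b (\<lambda>n r. r - 1) a = b - a" for a b :: nat by (induction a) auto
  ultimately show ?thesis by simp
qed

lemma rfun_if:
  assumes "rfun k c" "rfun k f" "rfun k g"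
  shows "rfun k (\<lambda>xs. if c xs = 0 then f xs else g xs)"
proof -
  have "rfun k (\<lambda>xs. rec_nat (f xs) (\<lambda>n r. g xs) (c xs))"
    using rfun_drop[OF assms(3), of 2] by (intro rfun_rec assms) (simp_all add: eval_nat_numeral)
  moreover have "rec_nat b (\<lambda>n r. d) a = (if a = 0 then b else d)" for a and b d :: nat
    by (cases a) auto
  ultimately show ?thesis by simp
qed

lemma rfun_triangle: assumes "rfun k f" shows "rfun k (\<lambda>xs. triangle (f xs))"
proof -
  have "rfun k (\<lambda>xs. rec_nat 0 (\<lambda>n r. r + Suc n) (f xs))"
    by (rule rfun_rec) (auto intro!: rfun_zero rfun_Suc rfun_proj assms rfun_add simp del: add_Suc_right)
  moreover have "rec_nat 0 (\<lambda>n r. r + Suc n) a = triangle a" for a by (induction a) auto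
  ultimately show ?thesis by simp
qed

text \<open>The largest \<open>s\<close> with \<open>triangle s \<le> n\<close>, written as a
  primitive recursion. It recovers \<open>a + b\<close> from the Cantor pairing code
  \<open>triangle (a + b) + a\<close>.\<close>

definition triangle_root :: "nat \<Rightarrow> nat" where
  "triangle_root n = rec_nat 0 (\<lambda>n s. if triangle (Suc s) - Suc n = 0 then Suc s else s) n"

lemma triangle_root_bounds: "triangle (triangle_root n) \<le> n \<and> n < triangle (Suc (triangle_root n))"
proof (induction n)
  case 0 then show ?case by (simp add: triangle_root_def)
next
  case (Suc n)
  have "triangle_root (Suc n) =
      (if triangle (Suc (triangle_root n)) - Suc n = 0 then Suc (triangle_root n) else triangle_root n)"
    by (simp add: triangle_root_def)
  with Suc show ?case by auto
qed

lemma triangle_root_prod_encode: "triangle_root (prod_encode (a, b)) = a + b"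
proof -
  have mono: "m \<le> n \<Longrightarrow> triangle m \<le> triangle n" for m n
    by (rule lift_Suc_mono_le[of triangle]) auto
  let ?n = "prod_encode (a, b)"
  have b: "triangle (a + b) \<le> ?n" "?n < triangle (Suc (a + b))"
    by (auto simp: prod_encode_def)
  have "\<not> triangle_root ?n < a + b"
    using triangle_root_bounds[of ?n] b(1) mono[of "Suc (triangle_root ?n)" "a + b"] by auto
  moreover have "\<not> a + b < triangle_root ?n"
    using triangle_root_bounds[of ?n] b(2) mono[of "Suc (a + b)" "triangle_root ?n"] by auto
  ultimately show ?thesis by linarith
qed

lemma fst_prod_decode: "fst (prod_decode n) = n - triangle (triangle_root n)"
  and snd_prod_decode: "snd (prod_decode n) = triangle_root n - fst (prod_decode n)"
proof -
  obtain a b where "n = prod_encode (a, b)" by (metis prod_decode_inverse surj_pair)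
  moreover have "prod_encode (a, b) - triangle (a + b) = a" by (simp add: prod_encode_def)
  ultimately show "fst (prod_decode n) = n - triangle (triangle_root n)"
    "snd (prod_decode n) = triangle_root n - fst (prod_decode n)"
    by (simp_all add: triangle_root_prod_encode)
qed

lemma rfun_triangle_root: assumes "rfun k f" shows "rfun k (\<lambda>xs. triangle_root (f xs))"
proof -
  have "rfun k (\<lambda>xs. rec_nat 0 (\<lambda>n s. if triangle (Suc s) - Suc n = 0 then Suc s else s) (f xs))"
    by (intro rfun_rec rfun_zero rfun_if rfun_diff rfun_triangle rfun_Suc rfun_proj assms) simp_all
  then show ?thesis by (simp add: triangle_root_def)
qed

lemma rfun_fst: "rfun k f \<Longrightarrow> rfun k (\<lambda>xs. fst (prod_decode (f xs)))"
  unfolding fst_prod_decode by (intro rfun_diff rfun_triangle rfun_triangle_root)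

lemma rfun_snd: "rfun k f \<Longrightarrow> rfun k (\<lambda>xs. snd (prod_decode (f xs)))"
  unfolding snd_prod_decode by (intro rfun_diff rfun_triangle_root rfun_fst)

lemma rfun_pair: "rfun k f \<Longrightarrow> rfun k g \<Longrightarrow> rfun k (\<lambda>xs. prod_encode (f xs, g xs))"
  unfolding prod_encode_def split by (intro rfun_add rfun_triangle)

section \<open>Unary functions on codes of pairs and lists\<close>

definition nfun :: "(nat \<Rightarrow> nat) \<Rightarrow> bool" where
  "nfun f \<longleftrightarrow> rfun 1 (\<lambda>xs. f (xs ! 0))"

lemma nfun_comp: "nfun f \<Longrightarrow> nfun g \<Longrightarrow> nfun (\<lambda>n. f (g n))"
  unfolding nfun_def by (rule rfun_comp1)

lemma nfun_id: "nfun (\<lambda>n. n)"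
  unfolding nfun_def by (rule rfun_proj) simp

lemma nfun_const: "nfun (\<lambda>_. n)"
  unfolding nfun_def by (rule rfun_const)

lemma nfun_Suc: "nfun f \<Longrightarrow> nfun (\<lambda>n. Suc (f n))"
  unfolding nfun_def by (rule rfun_Suc)

lemma nfun_diff: "nfun f \<Longrightarrow> nfun g \<Longrightarrow> nfun (\<lambda>n. f n - g n)"
  unfolding nfun_def by (rule rfun_diff)

lemma nfun_if: "nfun c \<Longrightarrow> nfun f \<Longrightarrow> nfun g \<Longrightarrow> nfun (\<lambda>n. if c n = 0 then f n else g n)"
  unfolding nfun_def by (rule rfun_if)

lemma nfun_pair: "nfun f \<Longrightarrow> nfun g \<Longrightarrow> nfun (\<lambda>n. prod_encode (f n, g n))"
  unfolding nfun_def by (rule rfun_pair)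

lemma nfun_fst: "nfun f \<Longrightarrow> nfun (\<lambda>n. fst (prod_decode (f n)))"
  unfolding nfun_def by (rule rfun_fst)

lemma nfun_snd: "nfun f \<Longrightarrow> nfun (\<lambda>n. snd (prod_decode (f n)))"
  unfolding nfun_def by (rule rfun_snd)

lemma nfun_funpow:
  assumes "nfun f" "nfun g" "nfun h" shows "nfun (\<lambda>n. (f ^^ g n) (h n))"
proof -
  have "rfun (Suc (Suc 1)) (\<lambda>xs. f (xs ! 1))"
    using assms(1) unfolding nfun_def by (rule rfun_comp1) (rule rfun_proj, simp)
  then have "rfun 1 (\<lambda>xs. rec_nat (h (xs ! 0)) (\<lambda>_ r. f r) (g (xs ! 0)))"
    using assms(2,3) unfolding nfun_def by (intro rfun_rec)
  moreover have "rec_nat a (\<lambda>_ r. f r) n = (f ^^ n) a" for a n by (induction n) auto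
  ultimately show ?thesis by (simp add: nfun_def)
qed

text \<open>The state is the code of the remaining list paired with the accumulator. A nonempty list
  is coded by the successor of a pair, so one step is computable. A list is no longer than its code,
  so the code itself bounds the number of steps; the step idles on the empty list.\<close>

lemma nfun_fold:
  assumes "nfun (\<lambda>p. g (fst (prod_decode p)) (snd (prod_decode p)))"
  shows "nfun (\<lambda>p. fold g (list_decode (fst (prod_decode p))) (snd (prod_decode p)))"
proof -
  define step where "step p = (if fst (prod_decode p) = 0 then p
    else prod_encode (snd (prod_decode (fst (prod_decode p) - 1)),
      g (fst (prod_decode (fst (prod_decode p) - 1))) (snd (prod_decode p))))" for p
  have "nfun (\<lambda>p. g (fst (prod_decode (fst (prod_decode p) - 1))) (snd (prod_decode p)))"
    using nfun_comp[OF assms, of "\<lambda>p. prod_encode (fst (prod_decode (fst (prod_decode p) - 1)), snd (prod_decode p))"]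
    by (simp add: nfun_pair nfun_fst nfun_snd nfun_diff nfun_const nfun_id)
  then have "nfun step"
    unfolding step_def by (intro nfun_if nfun_pair nfun_fst nfun_snd nfun_diff nfun_const nfun_id)
  then have "nfun (\<lambda>p. snd (prod_decode ((step ^^ fst (prod_decode p)) p)))"
    by (intro nfun_snd nfun_funpow nfun_fst nfun_id)
  moreover have step0: "step (prod_encode (0, a)) = prod_encode (0, a)" for a by (simp add: step_def)
  have "(step ^^ k) (prod_encode (list_encode xs, a)) = prod_encode (0, fold g xs a)" if "length xs \<le> k" for k xs a
    using that
  proof (induction k arbitrary: xs a)
    case (Suc k)
    show ?case
    proof (cases xs)
      case Nil
      with Suc.IH[of "[]" a] show ?thesis by (simp add: step0)
    next
      case (Cons y ys)
      have "step (prod_encode (list_encode xs, a)) = prod_encode (list_encode ys, g y a)"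
        by (simp add: step_def Cons)
      with Suc Cons show ?thesis by (simp add: funpow_swap1[symmetric] del: funpow.simps) (simp add: funpow_swap1)
    qed
  qed simp
  moreover have "length xs \<le> list_encode xs" for xs
    by (induction xs) (auto intro: order_trans le_prod_encode_2)
  ultimately have "snd (prod_decode ((step ^^ list_encode xs) (prod_encode (list_encode xs, a)))) = fold g xs a" for xs a
    by simp
  then have "snd (prod_decode ((step ^^ fst (prod_decode p)) p)) =
      fold g (list_decode (fst (prod_decode p))) (snd (prod_decode p))" for p
    by (metis list_decode_inverse prod.collapse prod_decode_inverse)
  with \<open>nfun (\<lambda>p. snd _)\<close> show ?thesis by simp
qed

text \<open>Consing in a fold reverses the list, so a second fold with the identity restores the
  order.\<close>

lemma nfun_map:
  assumes "nfun f" shows "nfun (\<lambda>n. list_encode (map f (list_decode n)))"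
proof -
  define g where "g h x a = Suc (prod_encode (h x, a))" for h :: "nat \<Rightarrow> nat" and x a
  have g: "fold (g h) xs (list_encode as) = list_encode (rev (map h xs) @ as)" for h xs as
    by (induction xs arbitrary: as) (simp_all add: g_def flip: list_encode.simps)
  have "nfun (\<lambda>p. fold (g h) (list_decode (fst (prod_decode p))) (snd (prod_decode p)))" if "nfun h" for h
    unfolding g_def
    by (rule nfun_fold) (intro nfun_Suc nfun_pair nfun_comp[OF that] nfun_fst nfun_snd nfun_id)
  from nfun_comp[OF this, of _ "\<lambda>n. prod_encode (n, 0)"]
  have "nfun (\<lambda>n. fold (g h) (list_decode n) 0)" if "nfun h" for h
    using that by (simp add: nfun_pair nfun_id nfun_const)
  from nfun_comp[OF this this, of "\<lambda>x. x" f] assms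
  have "nfun (\<lambda>n. fold (g (\<lambda>x. x)) (list_decode (fold (g f) (list_decode n) 0)) 0)"
    by (simp add: nfun_id)
  moreover have "fold (g h) xs 0 = list_encode (rev (map h xs))" for h xs
    using g[of h xs "[]"] by simp
  ultimately show ?thesis by (simp add: rev_map)
qed

section \<open>Coded types and the computable functions between them\<close>

text \<open>Since \<open>decode\<close> is total, a search over numbers reaches every element of the
  type; since \<open>code (decode n)\<close> is computable, the range of \<open>code\<close> is
  decidable.\<close>

class coded =
  fixes code :: "'a \<Rightarrow> nat" and decode :: "nat \<Rightarrow> 'a"
  assumes decode_code [simp]: "decode (code x) = x"
    and nfun_code_decode: "nfun (\<lambda>n. code (decode n))"

lemma code_eq_iff [simp]: "code x = code y \<longleftrightarrow> x = y" for x y :: "'a::coded"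
  by (metis decode_code)

instantiation nat :: coded
begin
definition "code_nat (n::nat) = n"
definition "decode_nat (n::nat) = n"
instance by standard (simp_all add: code_nat_def decode_nat_def nfun_id)
end

instantiation bool :: coded
begin
definition "code_bool (b::bool) = (of_bool b :: nat)"
definition "decode_bool (n::nat) \<longleftrightarrow> n \<noteq> 0"
instance
proof
  have "nfun (\<lambda>n. if n = 0 then 0 else 1)"
    by (intro nfun_if nfun_id nfun_const)
  moreover have "(\<lambda>n. code (decode n :: bool)) = (\<lambda>n. if n = 0 then 0 else 1)"
    by (auto simp: code_bool_def decode_bool_def)
  ultimately show "nfun (\<lambda>n. code (decode n :: bool))" by simp
qed (simp add: code_bool_def decode_bool_def)
end

instantiation prod :: (coded, coded) coded
begin
definition "code_prod p = prod_encode (code (fst p), code (snd p))"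
definition "decode_prod n = (decode (fst (prod_decode n)), decode (snd (prod_decode n)))"
instance
proof
  show "nfun (\<lambda>n. code (decode n :: 'a \<times> 'b))"
    by (simp add: code_prod_def decode_prod_def)
      (intro nfun_pair nfun_comp[OF nfun_code_decode[where 'a='a]]
        nfun_comp[OF nfun_code_decode[where 'a='b]] nfun_fst nfun_snd nfun_id)
qed (simp add: code_prod_def decode_prod_def)
end

instantiation list :: (coded) coded
begin
definition "code_list xs = list_encode (map code xs)"
definition "decode_list n = map decode (list_decode n)"
instance
proof
  show "nfun (\<lambda>n. code (decode n :: 'a list))"
    using nfun_map[OF nfun_code_decode[where 'a='a]] by (simp add: code_list_def decode_list_def o_def)
qed (simp add: code_list_def decode_list_def o_def)
end

text \<open>Ties the generic coding to the one by which c.e. sets of strings are defined.\<close>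

lemma string_code_eq_code: "string_code \<sigma> = code \<sigma>"
  by (simp add: string_code_def code_list_def code_bool_def[abs_def])

definition computable :: "('a::coded \<Rightarrow> 'b::coded) \<Rightarrow> bool" where
  "computable f \<longleftrightarrow> (\<exists>g. nfun g \<and> (\<forall>x. g (code x) = code (f x)))"

lemma computableI: "nfun g \<Longrightarrow> (\<And>x. g (code x) = code (f x)) \<Longrightarrow> computable f"
  unfolding computable_def by blast

lemma computable_comp:
  assumes "computable f" "computable g" shows "computable (\<lambda>x. f (g x))"
  using assms unfolding computable_def by (metis nfun_comp)

lemma computable_id: "computable (\<lambda>x. x)"
  by (rule computableI[OF nfun_id]) simp

lemma computable_const: "computable (\<lambda>_. c)"
  by (rule computableI[OF nfun_const]) simp

lemma computable_Pair:
  assumes "computable f" "computable g" shows "computable (\<lambda>x. (f x, g x))"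
proof -
  from assms obtain f' g' where "nfun f'" "\<forall>x. f' (code x) = code (f x)" "nfun g'" "\<forall>x. g' (code x) = code (g x)"
    unfolding computable_def by blast
  then show ?thesis by (intro computableI[OF nfun_pair[of f' g']]) (simp_all add: code_prod_def)
qed

lemma computable_fst: "computable f \<Longrightarrow> computable (\<lambda>x. fst (f x))"
  by (rule computable_comp[OF computableI[OF nfun_fst[OF nfun_id]]]) (simp add: code_prod_def)

lemma computable_snd: "computable f \<Longrightarrow> computable (\<lambda>x. snd (f x))"
  by (rule computable_comp[OF computableI[OF nfun_snd[OF nfun_id]]]) (simp add: code_prod_def)

lemma computable_comp2:
  "computable (\<lambda>p. f (fst p) (snd p)) \<Longrightarrow> computable g \<Longrightarrow> computable h \<Longrightarrow> computable (\<lambda>x. f (g x) (h x))"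
  using computable_comp[OF _ computable_Pair, of "\<lambda>p. f (fst p) (snd p)" g h] by simp

lemma computable_decode: "computable (\<lambda>n. decode n :: 'a::coded)"
  by (rule computableI[OF nfun_code_decode]) (simp add: code_nat_def)

lemma computable_code: "computable (code :: 'a::coded \<Rightarrow> nat)"
  by (rule computableI[OF nfun_id]) (simp add: code_nat_def)

lemma computable_if:
  assumes "computable c" "computable f" "computable g"
  shows "computable (\<lambda>x. if c x then f x else g x)"
proof -
  from assms obtain c' f' g' where "nfun f'" "\<forall>x. f' (code x) = code (f x)" "nfun g'" "\<forall>x. g' (code x) = code (g x)"
    "nfun c'" "\<forall>x. c' (code x) = code (c x)"
    unfolding computable_def by meson
  then show ?thesis by (intro computableI[OF nfun_if[of c' g' f']]) (simp_all add: code_bool_def)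
qed

text \<open>The iterated function may depend on the input. Iterating on pairs that carry
  \<open>x\<close> along unchanged reduces this to one fixed function on codes.\<close>

lemma computable_funpow:
  fixes f :: "'a::coded \<Rightarrow> 'b::coded \<Rightarrow> 'b"
  assumes f: "computable (\<lambda>p. f (fst p) (snd p))" and "computable n" "computable i"
  shows "computable (\<lambda>x. (f x ^^ n x) (i x))"
proof -
  define F where "F p = (fst p, f (fst p) (snd p))" for p
  have "computable F"
    unfolding F_def[abs_def] by (intro computable_Pair computable_fst computable_id f)
  then obtain F' n' i' where "nfun F'" and F': "\<forall>x. F' (code x) = code (F x)"
    and ni: "nfun n'" "\<forall>x. n' (code x) = code (n x)" "nfun i'" "\<forall>x. i' (code x) = code (i x)"
    using assms(2,3) unfolding computable_def by meson
  have F'n: "(F' ^^ k) (code p) = code ((F ^^ k) p)" for k p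
    by (induction k) (simp_all add: F')
  have Fn: "(F ^^ k) (x, y) = (x, (f x ^^ k) y)" for k x y
    by (induction k) (simp_all add: F_def)
  have "computable (\<lambda>x. (F ^^ n x) (x, i x))"
  proof (rule computableI)
    show "nfun (\<lambda>m. (F' ^^ n' m) (prod_encode (m, i' m)))"
      by (intro nfun_funpow nfun_pair nfun_id ni \<open>nfun F'\<close>)
    show "(F' ^^ n' (code x)) (prod_encode (code x, i' (code x))) = code ((F ^^ n x) (x, i x))" for x
      using F'n[of "n x" "(x, i x)"] by (simp add: ni code_nat_def code_prod_def)
  qed
  from computable_snd[OF this] show ?thesis by (simp add: Fn)
qed

lemma computable_Suc: "computable f \<Longrightarrow> computable (\<lambda>x. Suc (f x))"
  by (rule computable_comp[OF computableI[OF nfun_Suc[OF nfun_id]]]) (simp add: code_nat_def)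

lemma computable_diff: "computable f \<Longrightarrow> computable g \<Longrightarrow> computable (\<lambda>x. f x - g x :: nat)"
  by (rule computable_comp2[OF computableI[OF nfun_diff[OF nfun_fst[OF nfun_id] nfun_snd[OF nfun_id]]]])
    (simp_all add: code_nat_def code_prod_def)

lemma computable_not: assumes "computable P" shows "computable (\<lambda>x. \<not> P x)"
proof -
  have "(\<lambda>x. \<not> P x) = (\<lambda>x. if P x then False else True)" by auto
  with computable_if[OF assms computable_const[of False] computable_const[of True]] show ?thesis by simp
qed

lemma computable_conj: assumes "computable P" "computable Q" shows "computable (\<lambda>x. P x \<and> Q x)"
proof -
  have "(\<lambda>x. P x \<and> Q x) = (\<lambda>x. if P x then Q x else False)" by auto
  with computable_if[OF assms computable_const[of False]] show ?thesis by simp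
qed

lemma computable_disj: assumes "computable P" "computable Q" shows "computable (\<lambda>x. P x \<or> Q x)"
  using computable_not[OF computable_conj[OF computable_not computable_not, OF assms]] by simp

lemma computable_eq0: assumes "computable f" shows "computable (\<lambda>x. f x = (0::nat))"
proof -
  have "computable (decode :: nat \<Rightarrow> bool)" by (rule computable_decode)
  from computable_not[OF computable_comp[OF this assms]] show ?thesis
    by (simp add: decode_bool_def)
qed

lemma computable_le: assumes "computable f" "computable g" shows "computable (\<lambda>x. f x \<le> (g x :: nat))"
  using computable_eq0[OF computable_diff[OF assms]] by simp

lemma computable_less: assumes "computable f" "computable g" shows "computable (\<lambda>x. f x < (g x :: nat))"
  using computable_not[OF computable_le[OF assms(2,1)]] by (simp add: not_le)

lemma computable_eq: assumes "computable f" "computable g" shows "computable (\<lambda>x. f x = g x)"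
proof -
  have c: "computable (\<lambda>x. code (f x))" "computable (\<lambda>x. code (g x))"
    using assms by (auto intro: computable_comp[OF computable_code])
  have "(\<lambda>x. f x = g x) = (\<lambda>x. code (f x) \<le> code (g x) \<and> code (g x) \<le> code (f x))"
    by (rule ext) (simp only: code_eq_iff flip: order.eq_iff)
  with computable_conj[OF computable_le[OF c] computable_le[OF c(2,1)]] show ?thesis
    by simp
qed

lemma computable_Cons: "computable f \<Longrightarrow> computable g \<Longrightarrow> computable (\<lambda>x. f x # g x)"
  by (rule computable_comp2[OF computableI[OF nfun_Suc[OF nfun_id]]])
    (simp_all add: code_list_def code_prod_def)

lemma computable_hd: "computable f \<Longrightarrow> computable (\<lambda>x. hd (f x))"
proof (rule computable_comp[of hd])
  show "computable (hd :: 'b list \<Rightarrow> 'b)"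
  proof (rule computableI)
    show "nfun (\<lambda>n. if n = 0 then code (hd [] :: 'b) else fst (prod_decode (n - 1)))"
      by (intro nfun_if nfun_id nfun_fst nfun_diff nfun_const)
    show "(if code xs = 0 then code (hd [] :: 'b) else fst (prod_decode (code xs - 1))) = code (hd xs)" for xs :: "'b list"
      by (cases xs) (simp_all add: code_list_def)
  qed
qed

lemma computable_tl: "computable f \<Longrightarrow> computable (\<lambda>x. tl (f x))"
proof (rule computable_comp[of tl])
  show "computable (tl :: 'b list \<Rightarrow> 'b list)"
  proof (rule computableI)
    show "nfun (\<lambda>n. if n = 0 then 0 else snd (prod_decode (n - 1)))"
      by (intro nfun_if nfun_id nfun_snd nfun_diff nfun_const)
    show "(if code xs = 0 then 0 else snd (prod_decode (code xs - 1))) = code (tl xs)" for xs :: "'b list"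
      by (cases xs) (simp_all add: code_list_def)
  qed
qed

text \<open>The parameter \<open>x\<close> travels with the accumulator, as in
  \<open>computable_funpow\<close>. Most list operations below reduce to such folds.\<close>

lemma computable_fold:
  fixes h :: "'a::coded \<Rightarrow> 'e::coded \<Rightarrow> 'b::coded \<Rightarrow> 'b"
  assumes h: "computable (\<lambda>p. h (fst p) (fst (snd p)) (snd (snd p)))" and "computable l" "computable i"
  shows "computable (\<lambda>x. fold (h x) (l x) (i x))"
proof -
  define H where "H e p = (fst p, h (fst p) e (snd p))" for e p
  have "computable (\<lambda>q. (\<lambda>p. h (fst p) (fst (snd p)) (snd (snd p))) (fst (snd q), fst q, snd (snd q)))"
    by (rule computable_comp[OF h]) (intro computable_Pair computable_fst computable_snd computable_id)
  then have "computable (\<lambda>q. H (fst q) (snd q))"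
    unfolding H_def by (intro computable_Pair computable_fst computable_snd computable_id) simp
  then obtain H' where "nfun H'" and H': "\<forall>q. H' (code q) = code (H (fst q) (snd q))"
    unfolding computable_def by blast
  obtain l' i' where li: "nfun l'" "\<forall>x. l' (code x) = code (l x)" "nfun i'" "\<forall>x. i' (code x) = code (i x)"
    using assms(2,3) unfolding computable_def by meson
  define K where "K e p = H' (prod_encode (e, p))" for e p
  have K: "fold K (map code es) (code p) = code (fold H es p)" for es p
    by (induction es arbitrary: p) (use H' in \<open>simp_all add: K_def code_prod_def\<close>)
  have HF: "fold H es (x, y) = (x, fold (h x) es y)" for es x y
    by (induction es arbitrary: y) (simp_all add: H_def)
  have "computable (\<lambda>x. fold H (l x) (x, i x))"
  proof (rule computableI)
    have "nfun (\<lambda>p. K (fst (prod_decode p)) (snd (prod_decode p)))"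
      by (simp add: K_def \<open>nfun H'\<close>)
    from nfun_comp[OF nfun_fold[OF this], of "\<lambda>m. prod_encode (l' m, prod_encode (m, i' m))"]
    show "nfun (\<lambda>m. fold K (list_decode (l' m)) (prod_encode (m, i' m)))"
      by (simp add: nfun_pair nfun_id li)
    show "fold K (list_decode (l' (code x))) (prod_encode (code x, i' (code x))) = code (fold H (l x) (x, i x))" for x
      using K[of "l x" "(x, i x)"] by (simp add: li code_list_def code_prod_def)
  qed
  from computable_snd[OF this] show ?thesis by (simp add: HF)
qed

lemmas computable_basic = computable_Pair computable_fst computable_snd computable_id computable_const
  computable_Cons computable_Suc computable_diff computable_not computable_conj
  computable_disj computable_eq computable_le computable_less computable_if computable_hd computable_tl

lemma computable_rev: assumes "computable f" shows "computable (\<lambda>x. rev (f x))"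
proof -
  have "computable (\<lambda>x. fold (\<lambda>e a. e # a) (f x) [])"
    by (intro computable_fold computable_basic assms)
  then show ?thesis by (simp add: rev_conv_fold)
qed

lemma computable_append: assumes "computable f" "computable g" shows "computable (\<lambda>x. f x @ g x)"
proof -
  have "computable (\<lambda>x. fold (\<lambda>e a. e # a) (rev (f x)) (g x))"
    by (intro computable_fold computable_basic computable_rev assms)
  then show ?thesis by (simp add: fold_Cons_rev)
qed

lemma computable_map:
  fixes h :: "'a::coded \<Rightarrow> 'b::coded \<Rightarrow> 'c::coded"
  assumes "computable (\<lambda>p. h (fst p) (snd p))" "computable f"
  shows "computable (\<lambda>x. map (h x) (f x))"
proof -
  have "computable (\<lambda>p. h (fst p) (fst (snd p)))"
    using assms(1) by (rule computable_comp2) (intro computable_basic)+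
  then have "computable (\<lambda>x. rev (fold (\<lambda>e a. h x e # a) (f x) []))"
    by (intro computable_rev computable_fold computable_basic assms)
  moreover have "fold (\<lambda>e a. k e # a) es as = rev (map k es) @ as" for k :: "'b \<Rightarrow> 'c" and es as
    by (induction es arbitrary: as) auto
  ultimately show ?thesis by simp
qed

lemma computable_filter:
  fixes P :: "'a::coded \<Rightarrow> 'c::coded \<Rightarrow> bool"
  assumes "computable (\<lambda>p. P (fst p) (snd p))" "computable f"
  shows "computable (\<lambda>x. filter (P x) (f x))"
proof -
  have "computable (\<lambda>p. P (fst p) (fst (snd p)))"
    using assms(1) by (rule computable_comp2) (intro computable_basic)+
  then have "computable (\<lambda>x. rev (fold (\<lambda>e a. if P x e then e # a else a) (f x) []))"
    by (intro computable_rev computable_fold computable_basic assms)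
  moreover have "fold (\<lambda>e a. if Q e then e # a else a) es as = rev (filter Q es) @ as" for Q and es as :: "'c list"
    by (induction es arbitrary: as) auto
  ultimately show ?thesis by simp
qed

lemma computable_concat: assumes "computable f" shows "computable (\<lambda>x. concat (f x))"
proof -
  have "computable (\<lambda>x. fold (\<lambda>e a. e @ a) (rev (f x)) [])"
    by (intro computable_fold computable_basic computable_append computable_rev assms)
  moreover have "fold (\<lambda>e a. e @ a) (rev ess) as = concat ess @ as" for ess and as :: "'b list"
    by (induction ess arbitrary: as) auto
  ultimately show ?thesis by simp
qed

lemma computable_length: assumes "computable f" shows "computable (\<lambda>x. length (f x))"
proof -
  have "computable (\<lambda>x. fold (\<lambda>e a. Suc a) (f x) 0)"
    by (intro computable_fold computable_basic assms)
  moreover have "fold (\<lambda>e a. Suc a) es n = length es + n" for es :: "'b list" and n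
    by (induction es arbitrary: n) auto
  ultimately show ?thesis by simp
qed

lemma computable_ball:
  assumes "computable (\<lambda>p. P (fst p) (snd p))" "computable f"
  shows "computable (\<lambda>x. \<forall>e\<in>set (f x). P x e)"
proof -
  have "computable (\<lambda>p. P (fst p) (fst (snd p)))"
    using assms(1) by (rule computable_comp2) (intro computable_basic)+
  then have "computable (\<lambda>x. fold (\<lambda>e a. P x e \<and> a) (f x) True)"
    by (intro computable_fold computable_basic assms)
  moreover have "fold (\<lambda>e a. Q e \<and> a) es b \<longleftrightarrow> (\<forall>e\<in>set es. Q e) \<and> b" for Q and es :: "'b list" and b
    by (induction es arbitrary: b) auto
  ultimately show ?thesis by simp
qed

lemma computable_bex:
  assumes "computable (\<lambda>p. P (fst p) (snd p))" "computable f"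
  shows "computable (\<lambda>x. \<exists>e\<in>set (f x). P x e)"
  using computable_not[OF computable_ball[OF computable_not, OF assms]] by simp

lemma computable_member: assumes "computable f" "computable g" shows "computable (\<lambda>x. f x \<in> set (g x))"
proof -
  have "computable (\<lambda>x. \<exists>e\<in>set (g x). f x = e)"
    by (rule computable_bex[OF _ assms(2)])
      (intro computable_eq computable_comp[OF assms(1)] computable_basic)
  then show ?thesis by simp
qed

lemma computable_upt: assumes "computable f" shows "computable (\<lambda>x. [0..<f x])"
proof -
  have "computable (\<lambda>x. snd (((\<lambda>p. (Suc (fst p), snd p @ [fst p])) ^^ f x) (0, [])))"
    by (intro computable_funpow computable_basic computable_append assms)
  moreover have "((\<lambda>p. (Suc (fst p), snd p @ [fst p])) ^^ n) (0, []) = (n, [0..<n])" for n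
    by (induction n) auto
  ultimately show ?thesis by simp
qed

lemma computable_zip: assumes "computable f" "computable g" shows "computable (\<lambda>x. zip (f x) (g x))"
proof -
  define h where "h e p = (tl (fst p), if fst p = [] then snd p else (e, hd (fst p)) # snd p)"
    for e :: 'b and p :: "'c list \<times> ('b \<times> 'c) list"
  have "computable (\<lambda>x. rev (snd (fold h (f x) (g x, []))))"
    unfolding h_def by (intro computable_fold computable_basic computable_rev assms)
  moreover have "snd (fold h xs (ys, as)) = rev (zip xs ys) @ as" for xs ys as
    by (induction xs arbitrary: ys as) (auto simp: h_def neq_Nil_conv split: list.splits)
  ultimately show ?thesis by simp
qed

lemma computable_take: assumes "computable n" "computable f" shows "computable (\<lambda>x. take (n x) (f x))"
proof -
  have "computable (\<lambda>x. map fst (zip (f x) [0..<n x]))"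
    by (intro computable_map computable_basic computable_zip computable_upt assms)
  moreover have "map fst (zip xs [0..<k]) = take k xs" for xs :: "'b list" and k
    by (simp add: map_fst_zip_take)
      (metis length_take min.commute nat_le_linear take_all_iff take_take min_def length_take)
  ultimately show ?thesis by simp
qed

lemma computable_drop: assumes "computable n" "computable f" shows "computable (\<lambda>x. drop (n x) (f x))"
proof -
  have "computable (\<lambda>x. (tl ^^ n x) (f x))"
    by (intro computable_funpow computable_basic assms)
  moreover have "(tl ^^ k) xs = drop k xs" for xs :: "'b list" and k
    by (induction k) (auto simp: drop_Suc tl_drop)
  ultimately show ?thesis by simp
qed

lemmas computable_intros = computable_basic computable_rev computable_append computable_map computable_filter
  computable_concat computable_length computable_ball computable_bex computable_member computable_upt
  computable_zip computable_take computable_drop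

section \<open>Semidecidable predicates\<close>

definition semidec :: "('a::coded \<Rightarrow> bool) \<Rightarrow> bool" where
  "semidec P \<longleftrightarrow> (\<exists>R. computable R \<and> (\<forall>x. P x \<longleftrightarrow> (\<exists>n::nat. R (x, n))))"

text \<open>Witnesses may come from any coded type, because each element is \<open>decode n\<close>
  for some number \<open>n\<close>.\<close>

lemma semidecI:
  fixes R :: "'a::coded \<times> 'b::coded \<Rightarrow> bool"
  assumes "computable R" "\<And>x. P x \<longleftrightarrow> (\<exists>y. R (x, y))"
  shows "semidec P"
proof -
  have "computable (\<lambda>p. R (fst p, decode (snd p)))"
    by (rule computable_comp[OF assms(1)])
      (intro computable_basic computable_comp[OF computable_decode])
  moreover have "P x \<longleftrightarrow> (\<exists>n::nat. R (x, decode n))" for x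
    using assms(2) by (metis decode_code)
  ultimately show ?thesis
    unfolding semidec_def by (intro exI[of _ "\<lambda>p. R (fst p, decode (snd p))"]) simp
qed

lemma semidec_computable: assumes "computable P" shows "semidec P"
proof (rule semidecI)
  show "computable (\<lambda>p. P (fst p) :: bool)" for p :: "'a \<times> nat"
    by (intro computable_comp[OF assms] computable_basic)
qed simp

lemma semidec_comp: assumes "semidec P" "computable f" shows "semidec (\<lambda>x. P (f x))"
proof -
  obtain R where R: "computable R" "\<And>x. P x \<longleftrightarrow> (\<exists>n::nat. R (x, n))"
    using assms(1) unfolding semidec_def by blast
  show ?thesis
    by (rule semidecI[of "\<lambda>p. R (f (fst p), snd p)"])
      (auto simp: R(2) intro!: computable_comp[OF R(1)] computable_Pair computable_comp[OF assms(2)]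
        computable_fst computable_snd computable_id)
qed

lemma semidec_comp2:
  "semidec (\<lambda>p. P (fst p) (snd p)) \<Longrightarrow> computable f \<Longrightarrow> computable g \<Longrightarrow> semidec (\<lambda>x. P (f x) (g x))"
  using semidec_comp[of "\<lambda>p. P (fst p) (snd p)" "\<lambda>x. (f x, g x)"] by (simp add: computable_Pair)

lemma semidec_conj: assumes "semidec P" "semidec Q" shows "semidec (\<lambda>x. P x \<and> Q x)"
proof -
  obtain R where R: "computable R" "\<And>x. P x \<longleftrightarrow> (\<exists>n::nat. R (x, n))"
    using assms(1) unfolding semidec_def by blast
  obtain S where S: "computable S" "\<And>x. Q x \<longleftrightarrow> (\<exists>n::nat. S (x, n))"
    using assms(2) unfolding semidec_def by blast
  have "computable (\<lambda>p. R (fst p, fst (snd p)) \<and> S (fst p, snd (snd p)))"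
    by (intro computable_conj computable_comp[OF R(1)] computable_comp[OF S(1)] computable_Pair
      computable_fst computable_snd computable_id)
  then show ?thesis
    by (rule semidecI) (auto simp: R(2) S(2))
qed

lemma semidec_disj: assumes "semidec P" "semidec Q" shows "semidec (\<lambda>x. P x \<or> Q x)"
proof -
  obtain R where R: "computable R" "\<And>x. P x \<longleftrightarrow> (\<exists>n::nat. R (x, n))"
    using assms(1) unfolding semidec_def by blast
  obtain S where S: "computable S" "\<And>x. Q x \<longleftrightarrow> (\<exists>n::nat. S (x, n))"
    using assms(2) unfolding semidec_def by blast
  have "computable (\<lambda>p. R p \<or> S p)"
    by (intro computable_disj R S)
  then show ?thesis
    by (rule semidecI) (auto simp: R(2) S(2))
qed

lemma semidec_ex:
  fixes P :: "'a::coded \<Rightarrow> 'b::coded \<Rightarrow> bool"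
  assumes "semidec (\<lambda>p. P (fst p) (snd p))" shows "semidec (\<lambda>x. \<exists>y. P x y)"
proof -
  obtain R where R: "computable R" "\<And>p. P (fst p) (snd p) \<longleftrightarrow> (\<exists>n::nat. R (p, n))"
    using assms(1) unfolding semidec_def by blast
  have "computable (\<lambda>p. R ((fst p, fst (snd p)), snd (snd p)))"
    by (intro computable_comp[OF R(1)] computable_Pair computable_fst computable_snd computable_id)
  then show ?thesis
    by (rule semidecI) (use R(2)[of "(_, _)"] in auto)
qed

text \<open>Finitely many true instances have a common bound on their witnesses, so a single number
  \<open>N\<close> confirms them all.\<close>

lemma semidec_ball:
  fixes P :: "'a::coded \<Rightarrow> 'b::coded \<Rightarrow> bool"
  assumes "semidec (\<lambda>p. P (fst p) (snd p))" "computable l"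
  shows "semidec (\<lambda>x. \<forall>y\<in>set (l x). P x y)"
proof -
  obtain R where R: "computable R" "\<And>p. P (fst p) (snd p) \<longleftrightarrow> (\<exists>n::nat. R (p, n))"
    using assms(1) unfolding semidec_def by blast
  have "computable (\<lambda>p. \<forall>y\<in>set (l (fst p)). \<exists>n\<in>set [0..<snd p]. R ((fst p, y), n))"
    by (intro computable_ball computable_bex computable_upt computable_comp[OF R(1)]
      computable_comp[OF assms(2)] computable_Pair computable_fst computable_snd computable_id)
  then show ?thesis
  proof (rule semidecI)
    fix x
    have "\<exists>N. \<forall>y\<in>set ys. \<exists>n\<in>{0..<N}. R ((x, y), n)" if "\<forall>y\<in>set ys. \<exists>n. R ((x, y), n)" for ys
      using that
    proof (induction ys)
      case (Cons y ys)
      then obtain N m where N: "\<forall>y\<in>set ys. \<exists>n\<in>{0..<N}. R ((x, y), n)" "R ((x, y), m)" by auto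
      have "\<forall>z\<in>set (y # ys). \<exists>n\<in>{0..<max N (Suc m)}. R ((x, z), n)"
        using N by (fastforce simp: less_max_iff_disj)
      then show ?case by blast
    qed auto
    from this[of "l x"] show "(\<forall>y\<in>set (l x). P x y) \<longleftrightarrow>
        (\<exists>N. \<forall>y\<in>set (l (fst (x, N))). \<exists>n\<in>set [0..<snd (x, N)]. R ((fst (x, N), y), n))"
      using R(2)[of "(x, _)"] by auto
  qed
qed

lemma semidec_bex:
  fixes P :: "'a::coded \<Rightarrow> 'b::coded \<Rightarrow> bool"
  assumes "semidec (\<lambda>p. P (fst p) (snd p))" "computable l"
  shows "semidec (\<lambda>x. \<exists>y\<in>set (l x). P x y)"
  unfolding Bex_def
  by (rule semidec_ex semidec_conj assms(1) semidec_computable computable_member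
    computable_comp[OF assms(2)] computable_intros)+

section \<open>Halting of codes and c.e. sets\<close>

inductive_cases computes_ZeroE: "computes Zero xs y"
inductive_cases computes_SuccE: "computes Succ xs y"
inductive_cases computes_ProjE: "computes (Proj i) xs y"
inductive_cases computes_CompE: "computes (Comp f gs) xs y"
inductive_cases computes_PrimRec0E: "computes (PrimRec f g) (0 # xs) y"
inductive_cases computes_PrimRecSucE: "computes (PrimRec f g) (Suc n # xs) y"
inductive_cases computes_PrimRecE: "computes (PrimRec f g) xs y"
inductive_cases computes_MuE: "computes (Mu f) xs y"

lemma computes_functional: "computes f xs y \<Longrightarrow> computes f xs z \<Longrightarrow> y = z"
proof (induction arbitrary: z rule: computes.induct)
  case (Comp xs gs ys f y)
  from Comp.prems obtain ys' where ys': "list_all2 (\<lambda>g. computes g xs) gs ys'" "computes f ys' z"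
    by (rule computes_CompE)
  have "ys = ys'"
    using Comp.IH(1) ys'(1) by (auto simp: list_all2_conv_all_nth list_eq_iff_nth_eq)
  with Comp.IH(2) ys'(2) show ?case by blast
next
  case (PrimRec_Suc f g n xs r y)
  from PrimRec_Suc.prems PrimRec_Suc.IH show ?case by (elim computes_PrimRecSucE) blast
next
  case (Mu f n xs)
  from Mu.prems have z: "computes f (z # xs) 0" "\<And>m. m < z \<Longrightarrow> \<exists>k. 0 < k \<and> computes f (m # xs) k"
    by (blast elim: computes_MuE)+
  have "\<not> z < n" using Mu.IH(2) z(1) by fastforce
  moreover have "\<not> n < z" using Mu.IH(1) z(2) by fastforce
  ultimately show ?case by simp
qed (blast elim: computes_ZeroE computes_SuccE computes_ProjE computes_PrimRec0E)+

lemma computes_PrimRec_iff: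
  "computes (PrimRec f g) (n # zs) y \<longleftrightarrow>
    (\<exists>r. computes f zs (r 0) \<and> (\<forall>i<n. computes g (i # r i # zs) (r (Suc i))) \<and> r n = y)"
proof (induction n arbitrary: y)
  case 0
  have "computes (PrimRec f g) (0 # zs) y \<longleftrightarrow> computes f zs y"
    by (blast elim: computes_PrimRec0E intro: computes.PrimRec_0)
  also have "\<dots> \<longleftrightarrow> (\<exists>r. computes f zs (r (0::nat)) \<and> r 0 = y)"
    by (rule iffI[OF exI[of _ "\<lambda>_. y"]]) auto
  finally show ?case by simp
next
  case (Suc n)
  show ?case
  proof
    assume "computes (PrimRec f g) (Suc n # zs) y"
    then obtain a where "computes (PrimRec f g) (n # zs) a" and a: "computes g (n # a # zs) y"
      by (rule computes_PrimRecSucE)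
    then obtain r where r: "computes f zs (r 0)" "\<forall>i<n. computes g (i # r i # zs) (r (Suc i))" "r n = a"
      using Suc.IH by blast
    let ?r = "r(Suc n := y)"
    have "computes f zs (?r 0) \<and> (\<forall>i<Suc n. computes g (i # ?r i # zs) (?r (Suc i))) \<and> ?r (Suc n) = y"
      using r a by (auto simp: less_Suc_eq)
    then show "\<exists>r. computes f zs (r 0) \<and> (\<forall>i<Suc n. computes g (i # r i # zs) (r (Suc i))) \<and> r (Suc n) = y"
      by blast
  next
    assume "\<exists>r. computes f zs (r 0) \<and> (\<forall>i<Suc n. computes g (i # r i # zs) (r (Suc i))) \<and> r (Suc n) = y"
    then obtain r where r: "computes f zs (r 0)" "\<forall>i<Suc n. computes g (i # r i # zs) (r (Suc i))" "r (Suc n) = y"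
      by blast
    then have "computes (PrimRec f g) (n # zs) (r n)"
      using Suc.IH[of "r n"] by (auto intro!: exI[of _ r])
    moreover have "computes g (n # r n # zs) y" using r(2,3) by auto
    ultimately show "computes (PrimRec f g) (Suc n # zs) y" by (rule computes.PrimRec_Suc)
  qed
qed

text \<open>The trace of intermediate values becomes a list, hence a coded witness. Entries are
  written \<open>hd (drop i rs)\<close> because these operations are known to be computable; past
  the end the term still denotes some number, so every list yields a total trace.\<close>

lemma computes_PrimRec_iff_list:
  "computes (PrimRec f g) xs y \<longleftrightarrow> (\<exists>rs. xs \<noteq> [] \<and> computes f (tl xs) (hd rs) \<and>
     (\<forall>i\<in>set [0..<hd xs]. computes g (i # hd (drop i rs) # tl xs) (hd (drop (Suc i) rs))) \<and> hd (drop (hd xs) rs) = y)"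
  (is "_ \<longleftrightarrow> ?R")
proof (cases xs)
  case Nil
  then show ?thesis by (auto elim: computes_PrimRecE)
next
  case (Cons n zs)
  show ?thesis
  proof
    assume "computes (PrimRec f g) xs y"
    then obtain r where r: "computes f zs (r 0)" "\<forall>i<n. computes g (i # r i # zs) (r (Suc i))" "r n = y"
      unfolding Cons computes_PrimRec_iff by blast
    have "hd (drop i (map r [0..<Suc n])) = r i" if "i \<le> n" for i
      using that by (subst hd_drop_conv_nth) (auto simp del: upt_Suc)
    from this this[of 0] r show ?R
      unfolding Cons by (intro exI[of _ "map r [0..<Suc n]"]) (auto simp del: upt_Suc)
  next
    assume ?R
    then obtain rs where "computes f zs (hd rs)"
      "\<forall>i<n. computes g (i # hd (drop i rs) # zs) (hd (drop (Suc i) rs))" "hd (drop n rs) = y"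
      unfolding Cons by auto
    then show "computes (PrimRec f g) xs y"
      unfolding Cons computes_PrimRec_iff by (intro exI[of _ "\<lambda>i. hd (drop i rs)"]) auto
  qed
qed

text \<open>The code is fixed, so induction on it rewrites halting as an existential statement over
  coded data: the intermediate values for \<open>Comp\<close>, a trace for \<open>PrimRec\<close>,
  and finitely many positive values below the result for \<open>Mu\<close>.\<close>

lemma semidec_computes: "semidec (\<lambda>p. computes f (fst p) (snd p))"
proof (induction f)
  case Zero
  have "computes Zero xs y \<longleftrightarrow> y = 0" for xs y
    by (auto elim: computes_ZeroE intro: computes.Zero)
  then show ?case by (simp only:) (intro semidec_computable computable_intros)
next
  case Succ
  have "computes Succ xs y \<longleftrightarrow> xs \<noteq> [] \<and> y = Suc (hd xs)" for xs y
    by (cases xs) (auto elim: computes_SuccE intro: computes.Succ)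
  then show ?case by (simp only:) (intro semidec_computable computable_intros)
next
  case (Proj i)
  have "computes (Proj i) xs y \<longleftrightarrow> i < length xs \<and> y = hd (drop i xs)" for xs y
    by (auto elim!: computes_ProjE simp: hd_drop_conv_nth intro: computes.Proj)
  then show ?case by (simp only:) (intro semidec_computable computable_intros)
next
  case (Comp f gs)
  have gs: "semidec (\<lambda>p. list_all2 (\<lambda>g. computes g (fst p)) gs (snd p))"
    using Comp(2)
  proof (induction gs)
    case Nil
    then show ?case by simp (intro semidec_computable computable_intros)
  next
    case (Cons g gs)
    have "list_all2 (\<lambda>g. computes g xs) (g # gs) ys \<longleftrightarrow>
        ys \<noteq> [] \<and> computes g xs (hd ys) \<and> list_all2 (\<lambda>g. computes g xs) gs (tl ys)" for xs ys
      by (cases ys) auto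
    moreover have g: "semidec (\<lambda>p. computes g (fst p) (snd p))"
      using Cons.prems by simp
    moreover have gs: "semidec (\<lambda>p. list_all2 (\<lambda>g. computes g (fst p)) gs (snd p))"
      using Cons by simp
    ultimately show ?case
      by (simp only:) (rule semidec_conj semidec_comp2[OF g] semidec_comp2[OF gs]
          semidec_computable computable_intros)+
  qed
  have "computes (Comp f gs) xs y \<longleftrightarrow> (\<exists>ys. list_all2 (\<lambda>g. computes g xs) gs ys \<and> computes f ys y)" for xs y
    by (auto elim: computes_CompE intro: computes.Comp)
  then show ?case
    by (simp only:) (rule semidec_ex semidec_conj computable_intros
      semidec_comp2[OF Comp(1)] semidec_comp2[OF gs])+
next
  case (PrimRec f g)
  show ?case
    unfolding computes_PrimRec_iff_list
    by (rule semidec_ex semidec_conj semidec_ball semidec_comp2[OF PrimRec(1)] semidec_comp2[OF PrimRec(2)]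
      semidec_computable computable_intros)+
next
  case (Mu f)
  have "computes (Mu f) xs n \<longleftrightarrow> computes f (n # xs) 0 \<and>
      (\<forall>m\<in>set [0..<n]. \<exists>k. k > 0 \<and> computes f (m # xs) k)" for xs n
    by (auto elim: computes_MuE intro: computes.Mu)
  then show ?case
    by (simp only:) (rule semidec_ex semidec_conj semidec_ball semidec_comp2[OF Mu]
      semidec_computable computable_intros)+
qed

text \<open>Minimization looks for the first stage \<open>k\<close> that confirms \<open>n\<close>,
  so \<open>Mu c\<close> halts exactly on the codes of elements.\<close>

lemma semidec_imp_ce:
  assumes "semidec (\<lambda>x::'a::coded. x \<in> W)" shows "ce (code ` W)"
proof -
  obtain R where R: "computable R" "\<And>x. x \<in> W \<longleftrightarrow> (\<exists>n::nat. R (x, n))"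
    using assms unfolding semidec_def by blast
  \<comment> \<open>A number outside the range of \<open>code\<close> must be rejected, although
    \<open>decode\<close> may map it into \<open>W\<close>.\<close>
  define S where "S p \<longleftrightarrow> code (decode (snd p) :: 'a) = snd p \<and> R (decode (snd p), fst p)"
    for p :: "nat \<times> nat"
  have "computable (\<lambda>p. if S p then 0 else (1::nat))"
    unfolding S_def
    by (intro computable_intros computable_comp[OF R(1)] computable_comp[OF computable_code]
      computable_comp[OF computable_decode])
  then obtain h where h: "nfun h" "\<And>k n. h (prod_encode (k, n)) = (if S (k, n) then 0 else 1)"
    unfolding computable_def code_nat_def code_prod_def by auto
  have "rfun 2 (\<lambda>xs. h (prod_encode (xs ! 0, xs ! 1)))"
    using h(1) unfolding nfun_def by (rule rfun_comp1) (intro rfun_pair rfun_proj; simp)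
  then obtain c where "\<forall>xs. length xs = 2 \<longrightarrow> computes c xs (h (prod_encode (xs ! 0, xs ! 1)))"
    unfolding rfun_def by blast
  then have c: "computes c [k, n] (if S (k, n) then 0 else 1)" for k n
    by (drule_tac x="[k, n]" in spec) (simp add: h(2))
  have "(\<exists>k. computes (Mu c) [n] k) \<longleftrightarrow> (\<exists>k. S (k, n))" for n
  proof
    assume "\<exists>k. computes (Mu c) [n] k"
    then obtain k where "computes c [k, n] 0" by (blast elim: computes_MuE)
    with c[of k n] computes_functional[of c "[k, n]" 0 1] have "S (k, n)" by (auto split: if_splits)
    then show "\<exists>k. S (k, n)" ..
  next
    assume "\<exists>k. S (k, n)"
    then have L: "S (LEAST k. S (k, n), n)" by (rule LeastI_ex)
    have "computes (Mu c) [n] (LEAST k. S (k, n))"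
    proof (rule computes.Mu)
      show "computes c [LEAST k. S (k, n), n] 0" using c[of "LEAST k. S (k, n)" n] L by simp
      show "\<exists>k. 0 < k \<and> computes c [m, n] k" if "m < (LEAST k. S (k, n))" for m
        using c[of m n] not_less_Least[OF that] by auto
    qed
    then show "\<exists>k. computes (Mu c) [n] k" ..
  qed
  moreover have "n \<in> code ` W \<longleftrightarrow> (\<exists>k. S (k, n))" for n
    unfolding S_def using R(2) by (auto simp: image_iff) (metis decode_code)+
  ultimately have "code ` W = {n. \<exists>k. computes (Mu c) [n] k}" by blast
  then show ?thesis unfolding ce_def by blast
qed

lemma ce_image_code_iff: "ce (code ` W) \<longleftrightarrow> semidec (\<lambda>x::'a::coded. x \<in> W)"
proof
  assume "ce (code ` W)"
  then obtain f where f: "code ` W = {n. \<exists>y. computes f [n] y}"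
    unfolding ce_def by blast
  have "x \<in> W \<longleftrightarrow> (\<exists>y. computes f [code x] y)" for x
    using inj_image_mem_iff[of code x W] by (simp add: f inj_def)
  then show "semidec (\<lambda>x. x \<in> W)"
    by (simp only:) (rule semidec_ex semidec_comp2[OF semidec_computes] computable_comp[OF computable_code]
      computable_intros)+
qed (rule semidec_imp_ce)

lemma ce_strings_iff: "ce_strings W \<longleftrightarrow> semidec (\<lambda>\<sigma>. \<sigma> \<in> W)"
  unfolding ce_strings_def string_code_eq_code by (rule ce_image_code_iff)

lemma ce_string_pairs_iff: "ce_string_pairs W \<longleftrightarrow> semidec (\<lambda>p. p \<in> W)"
proof -
  have "(\<lambda>(\<sigma>, \<tau>). prod_encode (string_code \<sigma>, string_code \<tau>)) ` W = code ` W"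
    by (simp add: code_prod_def string_code_eq_code case_prod_beta)
  then show ?thesis unfolding ce_string_pairs_def by (simp add: ce_image_code_iff)
qed

text \<open>Replaces the closure by a coded witness, the path. \<open>zip (a # l) l\<close> lists
  its consecutive edges, since \<open>zip\<close> stops at the shorter list.\<close>

lemma trancl_iff_list:
  "(a, b) \<in> W\<^sup>+ \<longleftrightarrow> (\<exists>l. l \<noteq> [] \<and> hd (rev l) = b \<and> (\<forall>p\<in>set (zip (a # l) l). p \<in> W))"
proof
  show "\<exists>l. l \<noteq> [] \<and> hd (rev l) = b \<and> (\<forall>p\<in>set (zip (a # l) l). p \<in> W)" if "(a, b) \<in> W\<^sup>+"
    using that
  proof (induction rule: converse_trancl_induct)
    case (base a)
    then show ?case by (intro exI[of _ "[b]"]) auto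
  next
    case (step a c)
    then obtain l where "l \<noteq> [] \<and> hd (rev l) = b \<and> (\<forall>p\<in>set (zip (c # l) l). p \<in> W)" by blast
    with step.hyps(1) show ?case by (intro exI[of _ "c # l"]) auto
  qed
  have "(a, b) \<in> W\<^sup>+" if "l \<noteq> []" "hd (rev l) = b" "\<forall>p\<in>set (zip (a # l) l). p \<in> W" for l
    using that
  proof (induction l arbitrary: a)
    case (Cons c l)
    show ?case
    proof (cases "l = []")
      case True
      with Cons.prems show ?thesis by auto
    next
      case False
      with Cons have "(c, b) \<in> W\<^sup>+" "(a, c) \<in> W" by auto
      then show ?thesis by (meson trancl_into_trancl2)
    qed
  qed simp
  then show "(a, b) \<in> W\<^sup>+" if "\<exists>l. l \<noteq> [] \<and> hd (rev l) = b \<and> (\<forall>p\<in>set (zip (a # l) l). p \<in> W)"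
    using that by blast
qed

lemma semidec_trancl_Image:
  fixes W :: "('a::coded \<times> 'a) set"
  assumes "semidec (\<lambda>p. p \<in> W)"
  shows "semidec (\<lambda>b. b \<in> W\<^sup>+ `` set as)"
proof -
  have "b \<in> W\<^sup>+ `` set as \<longleftrightarrow>
      (\<exists>a\<in>set as. \<exists>l. l \<noteq> [] \<and> hd (rev l) = b \<and> (\<forall>p\<in>set (zip (a # l) l). p \<in> W))" for b
    by (simp only: Image_iff trancl_iff_list)
  then show ?thesis
    by (simp only:) (rule semidec_bex semidec_ex semidec_conj semidec_ball semidec_comp[OF assms]
      semidec_computable computable_intros)+
qed

section \<open>Recurrence\<close>

lemma space_cantor_measure [simp]: "space cantor_measure = UNIV"
  by (simp add: cantor_measure_def space_PiM)

lemma sets_cantor_measure_iff [simp, measurable_cong]: "sets cantor_measure = sets borel"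
  by (rule sets_cantor_measure)

interpretation cantor: prob_space cantor_measure
  by (rule prob_space_cantor_measure)

lemma borel_cylinder [measurable, simp]: "cylinder \<sigma> \<in> sets borel"
  by (rule borel_open) (rule open_cylinder)

lemma compact_cantor: "compact (UNIV :: cantor set)"
proof -
  have "compact_space (product_topology (\<lambda>_::nat. euclidean :: bool topology) UNIV)"
    unfolding compact_space_product_topology
    by (intro disjI2 ballI) (simp add: compact_space_def finite_imp_compact)
  then show ?thesis
    by (simp add: euclidean_product_topology compact_space_def)
qed

text \<open>Compactness turns a clopen set into finite data that an algorithm can contain as a
  constant.\<close>

lemma clopen_cylinders:
  assumes "clopen A" obtains \<sigma>s where "A = (\<Union>\<sigma>\<in>set \<sigma>s. cylinder \<sigma>)"
proof -
  from assms have "compact A" "open A"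
    using compact_Int_closed[OF compact_cantor, of A] by (auto simp: clopen_def)
  from \<open>open A\<close> obtain W where W: "A = (\<Union>\<sigma>\<in>W. cylinder \<sigma>)"
    by (auto simp only: open_iff_cylinders)
  obtain F where "F \<subseteq> W" "finite F" "A \<subseteq> (\<Union>\<sigma>\<in>F. cylinder \<sigma>)"
    by (rule compactE_image[OF \<open>compact A\<close>, of W cylinder]) (use W open_cylinder in auto)
  with W have "A = (\<Union>\<sigma>\<in>F. cylinder \<sigma>)" by blast
  moreover obtain \<sigma>s where "F = set \<sigma>s" using \<open>finite F\<close> finite_list by metis
  ultimately show ?thesis using that by blast
qed

section \<open>Iterates and return sets\<close>

lemma iterate_0 [simp]: "iterate T 0 y = Some y"
  by (simp add: iterate_def)

text \<open>The definition applies the last \<open>T\<close> outermost, whereas the inductions along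
  an orbit peel off the first one.\<close>

lemma iterate_Suc: "iterate T (Suc k) y = Option.bind (T y) (iterate T k)"
proof -
  have "((\<lambda>z. Option.bind z T) ^^ k) None = None" by (induction k) auto
  then show ?thesis
    unfolding iterate_def by (cases "T y") (simp_all add: funpow_Suc_right del: funpow.simps)
qed

lemma funpow_preimage: "(preimage T ^^ k) A = {y. \<exists>z\<in>A. iterate T k y = Some z}"
  by (induction k) (auto simp: preimage_def iterate_Suc bind_eq_Some_conv)

definition return_set :: "('a \<rightharpoonup> 'a) \<Rightarrow> 'a set \<Rightarrow> 'a set" where
  "return_set T A = (\<Union>k. (preimage T ^^ Suc k) A)"

lemma return_set_iff: "y \<in> return_set T A \<longleftrightarrow> (\<exists>k>0. \<exists>z\<in>A. iterate T k y = Some z)"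
  unfolding return_set_def funpow_preimage by (auto simp: gr0_conv_Suc)

text \<open>Taking the preimage raises every index in the union of the iterated preimages of
  \<open>A\<close> by one.\<close>

lemma preimage_Un_return_set: "preimage T (A \<union> return_set T A) = return_set T A"
proof -
  have "F 0 \<union> (\<Union>k. F (Suc k)) = (\<Union>k. F k)" for F :: "nat \<Rightarrow> 'a set"
    by (auto, metis not0_implies_Suc)
  from this[of "\<lambda>k. (preimage T ^^ k) A"] have "A \<union> return_set T A = (\<Union>k. (preimage T ^^ k) A)"
    by (simp add: return_set_def)
  moreover have "preimage T (\<Union>k. F k) = (\<Union>k. preimage T (F k))" for F :: "nat \<Rightarrow> _"
    by (auto simp: preimage_def)
  ultimately show ?thesis by (simp add: return_set_def)
qed

context
  fixes T assumes mpt: "measure_preserving_transformation T"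
begin

lemma borel_preimage: "B \<in> sets borel \<Longrightarrow> preimage T B \<in> sets borel"
  and emeasure_preimage: "B \<in> sets borel \<Longrightarrow> emeasure cantor_measure (preimage T B) = emeasure cantor_measure B"
  and range_subset_dom: "T y = Some z \<Longrightarrow> z \<in> dom T"
  using mpt unfolding measure_preserving_transformation_def by blast+

lemma borel_funpow_preimage: "B \<in> sets borel \<Longrightarrow> (preimage T ^^ k) B \<in> sets borel"
  by (induction k) (auto intro: borel_preimage)

lemma emeasure_funpow_preimage:
  "B \<in> sets borel \<Longrightarrow> emeasure cantor_measure ((preimage T ^^ k) B) = emeasure cantor_measure B"
  by (induction k) (auto simp: emeasure_preimage borel_funpow_preimage)

lemma borel_return_set: "A \<in> sets borel \<Longrightarrow> return_set T A \<in> sets borel"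
  unfolding return_set_def by (intro sets.countable_UN) (auto intro: borel_funpow_preimage simp del: funpow.simps)

text \<open>Poincare recurrence: \<open>A \<union> return_set T A\<close> and its preimage \<open>return_set T A\<close> have the same measure.\<close>

lemma null_not_return:
  assumes A: "A \<in> sets borel" shows "emeasure cantor_measure (A - return_set T A) = 0"
proof -
  let ?R = "return_set T A"
  have R: "?R \<in> sets borel" using A by (rule borel_return_set)
  have "emeasure cantor_measure (A \<union> ?R) = emeasure cantor_measure ?R"
    using emeasure_preimage[of "A \<union> ?R"] A R by (simp add: preimage_Un_return_set)
  moreover have "emeasure cantor_measure (A \<union> ?R - ?R) = emeasure cantor_measure (A \<union> ?R) - emeasure cantor_measure ?R"
    by (rule emeasure_Diff) (use A R in \<open>auto simp: cantor.emeasure_finite\<close>)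
  ultimately have "emeasure cantor_measure (A \<union> ?R - ?R) = 0"
    by simp
  moreover have "A \<union> ?R - ?R = A - ?R" by blast
  ultimately show ?thesis by simp
qed

text \<open>The return set \<open>R\<close> contains its preimage, which has the same measure; the intersection of the
  iterated preimages of \<open>R\<close> is strictly invariant.\<close>

lemma ergodic_return_set:
  assumes A: "A \<in> sets borel" and pos: "emeasure cantor_measure A > 0" and erg: "ergodic T"
  shows "emeasure cantor_measure (return_set T A) = 1"
proof -
  let ?R = "return_set T A"
  let ?B = "\<Inter>n. (preimage T ^^ n) ?R"
  have R: "?R \<in> sets borel" using A by (rule borel_return_set)
  have mono: "X \<subseteq> Y \<Longrightarrow> preimage T X \<subseteq> preimage T Y" for X Y
    by (auto simp: preimage_def)
  have "preimage T ?R \<subseteq> ?R"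
    using mono[of ?R "A \<union> ?R"] by (simp add: preimage_Un_return_set)
  then have "(preimage T ^^ Suc n) ?R \<subseteq> (preimage T ^^ n) ?R" for n
    by (induction n) (auto dest: mono)
  then have dec: "decseq (\<lambda>n. (preimage T ^^ n) ?R)"
    by (rule decseq_SucI)
  have "y \<in> preimage T (\<Inter>n. F n) \<longleftrightarrow> y \<in> (\<Inter>n. preimage T (F n))" for F :: "nat \<Rightarrow> _" and y
    by (cases "T y") (auto simp: preimage_def)
  then have "preimage T (\<Inter>n. F n) = (\<Inter>n. preimage T (F n))" for F :: "nat \<Rightarrow> _"
    by blast
  then have "preimage T ?B = (\<Inter>n. (preimage T ^^ Suc n) ?R)"
    by simp
  also have "\<dots> = ?B"
    using decseq_SucD[OF dec] by blast
  finally have "preimage T ?B = ?B" .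
  moreover have "?B \<in> sets borel"
    by (intro sets.countable_INT) (auto intro: borel_funpow_preimage R)
  ultimately have "emeasure cantor_measure ?B = 0 \<or> emeasure cantor_measure ?B = 1"
    using erg unfolding ergodic_def by blast
  moreover have "emeasure cantor_measure ?B = (INF n. emeasure cantor_measure ((preimage T ^^ n) ?R))"
    by (rule INF_emeasure_decseq[symmetric])
      (auto simp: dec borel_funpow_preimage R cantor.emeasure_finite)
  then have "emeasure cantor_measure ?B = emeasure cantor_measure ?R"
    by (simp add: emeasure_funpow_preimage R)
  moreover have "emeasure cantor_measure A \<le> emeasure cantor_measure ?R"
  proof -
    have "preimage T A \<subseteq> ?R" unfolding return_set_def by (intro UN_upper[of 0, THEN order_trans[rotated]]) auto
    then have "emeasure cantor_measure (preimage T A) \<le> emeasure cantor_measure ?R"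
      by (intro emeasure_mono) (auto simp: R)
    then show ?thesis by (simp add: emeasure_preimage A)
  qed
  ultimately show ?thesis using pos by auto
qed

text \<open>One step of \<open>W\<close> pulls a cylinder back along \<open>T\<close>, so
  \<open>k\<close> steps pull it back along the \<open>k\<close>th iterate. As \<open>T\<close> maps
  its domain into itself, the description of preimages by \<open>W\<close> is exact at every point
  of the orbit.\<close>

lemma iterate_cylinder_iff:
  assumes W: "\<And>\<sigma>. preimage T (cylinder \<sigma>) = dom T \<inter> (\<Union>\<tau>\<in>{\<tau>. (\<sigma>, \<tau>) \<in> W}. cylinder \<tau>)"
    and "y \<in> dom T"
  shows "(\<exists>z\<in>cylinder \<sigma>. iterate T k y = Some z) \<longleftrightarrow> (\<exists>\<tau>. (\<sigma>, \<tau>) \<in> W ^^ k \<and> y \<in> cylinder \<tau>)"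
  using \<open>y \<in> dom T\<close>
proof (induction k arbitrary: y)
  case (Suc k)
  from Suc.prems obtain z where z: "T y = Some z" by auto
  have "(\<exists>u\<in>cylinder \<sigma>. iterate T (Suc k) y = Some u) \<longleftrightarrow> (\<exists>\<tau>. (\<sigma>, \<tau>) \<in> W ^^ k \<and> z \<in> cylinder \<tau>)"
    using Suc.IH[OF range_subset_dom[OF z]] by (simp add: iterate_Suc z)
  also have "\<dots> \<longleftrightarrow> (\<exists>\<tau>. (\<sigma>, \<tau>) \<in> W ^^ k \<and> y \<in> preimage T (cylinder \<tau>))"
    by (simp add: preimage_def z)
  also have "\<dots> \<longleftrightarrow> (\<exists>\<tau>. (\<sigma>, \<tau>) \<in> W ^^ Suc k \<and> y \<in> cylinder \<tau>)"
    unfolding W using Suc.prems by auto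
  finally show ?case .
qed simp

lemma return_set_cylinders:
  assumes W: "\<And>\<sigma>. preimage T (cylinder \<sigma>) = dom T \<inter> (\<Union>\<tau>\<in>{\<tau>. (\<sigma>, \<tau>) \<in> W}. cylinder \<tau>)"
  shows "return_set T (\<Union>\<sigma>\<in>S. cylinder \<sigma>) = dom T \<inter> (\<Union>\<tau>\<in>W\<^sup>+ `` S. cylinder \<tau>)"
proof (rule set_eqI)
  fix y
  have dom: "y \<in> dom T" if "y \<in> return_set T (\<Union>\<sigma>\<in>S. cylinder \<sigma>)"
    using that by (auto simp: return_set_iff gr0_conv_Suc iterate_Suc bind_eq_Some_conv)
  have "y \<in> return_set T (\<Union>\<sigma>\<in>S. cylinder \<sigma>) \<longleftrightarrow> (\<exists>\<sigma>\<in>S. \<exists>k>0. \<exists>z\<in>cylinder \<sigma>. iterate T k y = Some z)"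
    unfolding return_set_iff by blast
  also have "\<dots> \<longleftrightarrow> (\<exists>\<sigma>\<in>S. \<exists>k>0. \<exists>\<tau>. (\<sigma>, \<tau>) \<in> W ^^ k \<and> y \<in> cylinder \<tau>)" if "y \<in> dom T"
    using iterate_cylinder_iff[OF W that] by simp
  also have "(\<exists>\<sigma>\<in>S. \<exists>k>0. \<exists>\<tau>. (\<sigma>, \<tau>) \<in> W ^^ k \<and> y \<in> cylinder \<tau>) \<longleftrightarrow> y \<in> (\<Union>\<tau>\<in>W\<^sup>+ `` S. cylinder \<tau>)"
    unfolding UN_iff Bex_def Image_iff trancl_power by blast
  finally have "y \<in> dom T \<Longrightarrow> y \<in> return_set T (\<Union>\<sigma>\<in>S. cylinder \<sigma>) \<longleftrightarrow> y \<in> (\<Union>\<tau>\<in>W\<^sup>+ `` S. cylinder \<tau>)" .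
  with dom show "y \<in> return_set T (\<Union>\<sigma>\<in>S. cylinder \<sigma>) \<longleftrightarrow> y \<in> dom T \<inter> (\<Union>\<tau>\<in>W\<^sup>+ `` S. cylinder \<tau>)"
    by blast
qed

end

text \<open>The two notions of recurrence share the enumeration of \<open>V\<close> and differ in
  the null set: \<open>A - V\<close> by Poincare recurrence if \<open>x \<in> A\<close>, and
  \<open>- V\<close> by ergodicity otherwise.\<close>

lemma kurtz_random_recurrent:
  assumes x: "kurtz_random x" "x \<in> dom T" and A: "clopen A" "emeasure cantor_measure A > 0"
    and T: "measure_preserving_transformation T" "computable_transformation T"
    and *: "x \<in> A \<or> ergodic T"
  shows "\<exists>k>0. \<exists>y\<in>A. iterate T k x = Some y"
proof -
  obtain W where "ce_string_pairs W"
    and W: "\<And>\<sigma>. preimage T (cylinder \<sigma>) = dom T \<inter> (\<Union>\<tau>\<in>{\<tau>. (\<sigma>, \<tau>) \<in> W}. cylinder \<tau>)"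
    using T(2) unfolding computable_transformation_def by blast
  then have sW: "semidec (\<lambda>p. p \<in> W)" by (simp add: ce_string_pairs_iff)
  obtain \<sigma>s where \<sigma>s: "A = (\<Union>\<sigma>\<in>set \<sigma>s. cylinder \<sigma>)" using A(1) by (rule clopen_cylinders)
  have "clopen (- A)" using A(1) by (auto simp: clopen_def)
  then obtain \<tau>s where \<tau>s: "- A = (\<Union>\<sigma>\<in>set \<tau>s. cylinder \<sigma>)" by (rule clopen_cylinders)
  define V where "V = (\<Union>\<tau>\<in>W\<^sup>+ `` set \<sigma>s. cylinder \<tau>)"
  have V: "return_set T A = dom T \<inter> V"
    unfolding V_def \<sigma>s by (rule return_set_cylinders[OF T(1) W])
  have Ab: "A \<in> sets borel" using A(1) by (auto simp: clopen_def)
  have Vo: "open V" unfolding V_def by (auto intro: open_cylinder)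
  have "x \<in> V"
  proof (cases "x \<in> A")
    case True
    \<comment> \<open>The list for \<open>- A\<close> is added because the complement of
      \<open>A - V\<close> is \<open>- A \<union> V\<close>.\<close>
    have "semidec (\<lambda>\<tau>. \<tau> \<in> set \<tau>s \<or> \<tau> \<in> W\<^sup>+ `` set \<sigma>s)"
      by (intro semidec_disj semidec_trancl_Image sW semidec_computable computable_member
        computable_id computable_const)
    then have "ce_strings (set \<tau>s \<union> W\<^sup>+ `` set \<sigma>s)"
      by (simp add: ce_strings_iff)
    moreover have "- A \<union> V = (\<Union>\<tau>\<in>set \<tau>s \<union> W\<^sup>+ `` set \<sigma>s. cylinder \<tau>)"
      unfolding \<tau>s V_def by blast
    ultimately have "Sigma01 (- A \<union> V)" unfolding Sigma01_def by blast
    then have "Pi01 (A - V)" by (simp add: Pi01_def Compl_Diff_eq)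
    \<comment> \<open>Outside \<open>dom T\<close> the set \<open>V\<close> may be larger than the
      return set, which only makes \<open>A - V\<close> smaller.\<close>
    moreover have "emeasure cantor_measure (A - V) \<le> emeasure cantor_measure (A - return_set T A)"
      using Ab borel_return_set[OF T(1) Ab] by (intro emeasure_mono) (auto simp: V)
    then have "A - V \<in> null_sets cantor_measure"
      using null_not_return[OF T(1) Ab] Ab Vo by (auto simp: null_sets_def)
    ultimately show ?thesis using x(1) True unfolding kurtz_random_def by blast
  next
    case False
    have "ce_strings (W\<^sup>+ `` set \<sigma>s)"
      unfolding ce_strings_iff by (rule semidec_trancl_Image[OF sW])
    then have "Pi01 (- V)" unfolding Pi01_def Sigma01_def V_def by auto
    moreover have "emeasure cantor_measure (return_set T A) = 1"
      using False * by (intro ergodic_return_set T Ab A(2)) blast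
    moreover have "emeasure cantor_measure (return_set T A) \<le> emeasure cantor_measure V"
      using Vo by (intro emeasure_mono) (auto simp: V)
    ultimately have "emeasure cantor_measure V = 1"
      by (simp add: antisym cantor.emeasure_le_1)
    then have "- V \<in> null_sets cantor_measure"
      using Vo cantor.prob_compl[of V] by (auto simp: null_sets_def Compl_eq_Diff_UNIV cantor.emeasure_eq_measure)
    with \<open>Pi01 (- V)\<close> show ?thesis using x(1) unfolding kurtz_random_def by blast
  qed
  with x(2) V show ?thesis by (simp flip: return_set_iff)
qed

section \<open>Conjugates of the shift\<close>

definition sdrop :: "nat \<Rightarrow> cantor \<Rightarrow> cantor" where
  "sdrop n y = (\<lambda>i. y (n + i))"

definition conc :: "bool list \<Rightarrow> cantor \<Rightarrow> cantor" where
  "conc \<sigma> z = (\<lambda>i. if i < length \<sigma> then \<sigma> ! i else z (i - length \<sigma>))"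

lemma mem_cylinder_iff: "y \<in> cylinder \<sigma> \<longleftrightarrow> map y [0..<length \<sigma>] = \<sigma>"
  unfolding cylinder_def by (subst list_eq_iff_nth_eq) simp

lemma conc_mem_cylinder [simp]: "conc \<sigma> z \<in> cylinder \<sigma>"
  by (simp add: cylinder_def conc_def)

lemma sdrop_conc [simp]: "sdrop (length \<sigma>) (conc \<sigma> z) = z"
  by (simp add: sdrop_def conc_def)

lemma conc_sdrop: "y \<in> cylinder \<sigma> \<Longrightarrow> conc \<sigma> (sdrop (length \<sigma>) y) = y"
  by (auto simp: cylinder_def conc_def sdrop_def)

lemma cylinder_append: "cylinder (\<sigma> @ \<tau>) = cylinder \<sigma> \<inter> sdrop (length \<sigma>) -` cylinder \<tau>"
proof -
  have "map y [0..<n + m] = map y [0..<n] @ map (sdrop n y) [0..<m]" for y :: cantor and n m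
    by (induction m) (simp_all add: sdrop_def)
  then show ?thesis by (auto simp: mem_cylinder_iff)
qed

lemma cylinder_Nil [simp]: "cylinder [] = UNIV"
  by (simp add: cylinder_def)

lemma cylinder_Int:
  assumes "length \<sigma> \<le> length \<tau>" shows "cylinder \<sigma> \<inter> cylinder \<tau> = (if take (length \<sigma>) \<tau> = \<sigma> then cylinder \<tau> else {})"
proof -
  have "map y [0..<length \<sigma>] = take (length \<sigma>) (map y [0..<length \<tau>])" for y :: cantor
    using assms by (simp add: take_map)
  then show ?thesis by (auto simp: mem_cylinder_iff)
qed

lemma measurable_sdrop [measurable]: "sdrop n \<in> borel_measurable borel"
  unfolding sdrop_def
  by (intro borel_measurable_continuous_onI continuous_on_coordinatewise_then_product continuous_on_product_coordinates)

lemma measurable_conc [measurable]: "conc \<sigma> \<in> borel_measurable borel"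
proof (intro borel_measurable_continuous_onI continuous_on_coordinatewise_then_product)
  show "continuous_on UNIV (\<lambda>z. conc \<sigma> z i)" for i
    by (cases "i < length \<sigma>") (auto simp: conc_def intro: continuous_on_product_coordinates)
qed

lemma sets_borel_cylinders: "sets (borel :: cantor measure) = sigma_sets UNIV (insert {} (range cylinder))"
proof (rule antisym)
  have "U \<in> sigma_sets UNIV (insert {} (range cylinder))" if "open U" for U
  proof -
    from that obtain W where "U = (\<Union>\<sigma>\<in>W. cylinder \<sigma>)"
      by (auto simp only: open_iff_cylinders)
    then show ?thesis
      by (auto intro!: sigma_sets_UNION intro: sigma_sets.Basic)
  qed
  then show "sets (borel :: cantor measure) \<subseteq> sigma_sets UNIV (insert {} (range cylinder))"
    unfolding sets_borel by (intro sigma_sets_mono) auto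
  show "sigma_sets UNIV (insert {} (range cylinder)) \<subseteq> sets borel"
    using sets.sigma_sets_subset[of "insert {} (range cylinder)" "borel :: cantor measure"]
    by (simp add: image_subset_iff)
qed

lemma prob_cylinder: "cantor.prob (cylinder \<sigma>) = (1/2) ^ length \<sigma>"
  by (simp add: measure_def emeasure_cylinder)

text \<open>Dynkin argument: as functions of \<open>C\<close> both sides are finite measures, and
  they agree on the cylinders, which with the empty set are closed under intersection. The empty
  string shows that \<open>c\<close> is the measure of \<open>D\<close>. Used with shifts for the
  independence of prefix and tail, and with the identity for ergodicity.\<close>

lemma prob_Int_vimage:
  assumes D: "D \<in> sets borel" and f: "f \<in> borel_measurable borel"
    and cyl: "\<And>\<sigma>. cantor.prob (D \<inter> f -` cylinder \<sigma>) = c * cantor.prob (cylinder \<sigma>)"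
    and C: "C \<in> sets borel"
  shows "cantor.prob (D \<inter> f -` C) = c * cantor.prob C"
proof -
  have fb: "f -` B \<in> sets borel" if "B \<in> sets borel" for B
    using measurable_sets[OF f that] by simp
  have c: "cantor.prob D = c"
    using cyl[of "[]"] cantor.prob_space by simp
  have "cylinder \<sigma> \<inter> cylinder \<tau> \<in> insert {} (range cylinder)" for \<sigma> \<tau>
    by (cases "length \<sigma> \<le> length \<tau>")
      (use cylinder_Int[of \<sigma> \<tau>] cylinder_Int[of \<tau> \<sigma>] in \<open>auto simp: Int_commute\<close>)
  then have "Int_stable (insert {} (range cylinder))"
    unfolding Int_stable_def by blast
  moreover have "insert {} (range cylinder) \<subseteq> Pow UNIV" by simp
  moreover have "C \<in> sigma_sets UNIV (insert {} (range cylinder))"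
    using C by (simp add: sets_borel_cylinders)
  ultimately show ?thesis
  proof (induction rule: sigma_sets_induct_disjoint)
    case (basic A)
    then show ?case by (auto simp: cyl)
  next
    case (compl A)
    have A: "A \<in> sets borel" using compl by (simp add: sets_borel_cylinders)
    have "cantor.prob (D - D \<inter> f -` A) = cantor.prob D - cantor.prob (D \<inter> f -` A)"
      by (rule cantor.finite_measure_Diff) (use D fb[OF A] in auto)
    moreover have "D \<inter> f -` (UNIV - A) = D - D \<inter> f -` A" by auto
    moreover have "cantor.prob (UNIV - A) = 1 - cantor.prob A"
      using cantor.prob_compl[of A] A by simp
    ultimately show ?case using compl.IH c by (simp add: right_diff_distrib)
  next
    case (union A)
    have A: "A i \<in> sets borel" for i using union.hyps(2) by (auto simp: sets_borel_cylinders)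
    have "(\<lambda>i. cantor.prob (D \<inter> f -` A i)) sums cantor.prob (\<Union>i. D \<inter> f -` A i)"
      by (rule cantor.finite_measure_UNION)
        (use union.hyps(1) A D fb in \<open>auto simp: disjoint_family_on_def\<close>)
    moreover have "(\<lambda>i. cantor.prob (A i)) sums cantor.prob (\<Union>i. A i)"
      by (rule cantor.finite_measure_UNION) (use union.hyps(1) A in auto)
    then have "(\<lambda>i. c * cantor.prob (A i)) sums (c * cantor.prob (\<Union>i. A i))"
      by (rule sums_mult)
    moreover have "(\<Union>i. D \<inter> f -` A i) = D \<inter> f -` (\<Union>i. A i)" by auto
    ultimately show ?case using union.IH by (simp add: sums_unique2)
  qed simp
qed

lemma prob_cylinder_Int_sdrop:
  assumes "C \<in> sets borel"
  shows "cantor.prob (cylinder \<tau> \<inter> sdrop (length \<tau>) -` C) = (1/2) ^ length \<tau> * cantor.prob C"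
proof (rule prob_Int_vimage[OF _ _ _ assms])
  show "cantor.prob (cylinder \<tau> \<inter> sdrop (length \<tau>) -` cylinder \<sigma>) = (1/2) ^ length \<tau> * cantor.prob (cylinder \<sigma>)" for \<sigma>
    using prob_cylinder[of "\<tau> @ \<sigma>"] by (simp add: cylinder_append prob_cylinder power_add)
qed (auto intro: measurable_sdrop)

section \<open>Measure-preserving total maps\<close>

definition preserves_measure :: "(cantor \<Rightarrow> cantor) \<Rightarrow> bool" where
  "preserves_measure f \<longleftrightarrow> f \<in> borel_measurable borel \<and> (\<forall>B\<in>sets borel. cantor.prob (f -` B) = cantor.prob B)"

lemma borel_vimage:
  "f \<in> borel_measurable borel \<Longrightarrow> B \<in> sets borel \<Longrightarrow> f -` B \<in> sets (borel :: cantor measure)"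
  using measurable_sets[of f borel borel B] by simp

lemma preserves_measure_vimage: "preserves_measure f \<Longrightarrow> B \<in> sets borel \<Longrightarrow> f -` B \<in> sets borel"
  unfolding preserves_measure_def by (blast intro: borel_vimage)

lemma preserves_measure_prob: "preserves_measure f \<Longrightarrow> B \<in> sets borel \<Longrightarrow> cantor.prob (f -` B) = cantor.prob B"
  unfolding preserves_measure_def by blast

lemma preserves_measure_AE:
  assumes "preserves_measure f" "AE y in cantor_measure. P y"
  shows "AE y in cantor_measure. P (f y)"
proof -
  from assms(2) obtain N where "{y \<in> space cantor_measure. \<not> P y} \<subseteq> N"
    "emeasure cantor_measure N = 0" "N \<in> sets cantor_measure"
    by (rule AE_E)
  then have N: "{y. \<not> P y} \<subseteq> N" "N \<in> sets borel" "cantor.prob N = 0"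
    by (simp_all add: measure_def)
  have "f -` N \<in> sets borel"
    by (rule preserves_measure_vimage[OF assms(1) N(2)])
  moreover have "cantor.prob (f -` N) = 0"
    using preserves_measure_prob[OF assms(1) N(2)] N(3) by simp
  ultimately have "f -` N \<in> null_sets cantor_measure"
    by (simp add: null_sets_def cantor.emeasure_eq_measure)
  then show ?thesis by (rule AE_I') (use N(1) in auto)
qed

text \<open>Each value of the dropped bit contributes half of the measure of
  \<open>B\<close>.\<close>

lemma preserves_measure_shift: "preserves_measure (sdrop (Suc 0))"
  unfolding preserves_measure_def
proof (intro conjI ballI measurable_sdrop)
  fix B :: "cantor set" assume B: "B \<in> sets borel"
  let ?S = "sdrop (Suc 0) -` B"
  have S: "?S \<in> sets borel" using measurable_sets[OF measurable_sdrop B] by simp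
  have U: "UNIV = cylinder [False] \<union> cylinder [True]" "cylinder [False] \<inter> cylinder [True] = {}"
    by (auto simp: cylinder_def)
  have "?S = (cylinder [False] \<inter> ?S) \<union> (cylinder [True] \<inter> ?S)" using U(1) by blast
  also have "cantor.prob \<dots> = cantor.prob (cylinder [False] \<inter> ?S) + cantor.prob (cylinder [True] \<inter> ?S)"
    by (rule cantor.finite_measure_Union) (use S U(2) in auto)
  also have "\<dots> = cantor.prob B"
    using prob_cylinder_Int_sdrop[OF B, of "[False]"] prob_cylinder_Int_sdrop[OF B, of "[True]"] by simp
  finally show "cantor.prob ?S = cantor.prob B" .
qed

lemma prob_singleton: "cantor.prob {q} = 0"
proof -
  have "cantor.prob {q} \<le> (1/2) ^ n" for n
  proof -
    have "cantor.prob {q} \<le> cantor.prob (cylinder (map q [0..<n]))"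
      by (rule cantor.finite_measure_mono) (auto simp: mem_cylinder_iff)
    then show ?thesis by (simp add: prob_cylinder)
  qed
  moreover have "(\<lambda>n. (1/2::real) ^ n) \<longlonglongrightarrow> 0" by (rule LIMSEQ_realpow_zero) auto
  ultimately have "cantor.prob {q} \<le> 0" by (meson LIMSEQ_le_const)
  then show ?thesis by (simp add: order.antisym)
qed

lemma borel_singleton: "{q} \<in> sets (borel :: cantor measure)"
proof -
  have "{q} = (\<Inter>n. cylinder (map q [0..<n]))"
  proof (rule set_eqI, rule iffI)
    fix y assume "y \<in> (\<Inter>n. cylinder (map q [0..<n]))"
    then have "y i = q i" for i by (auto simp: cylinder_def simp del: upt_Suc dest: spec[of _ "Suc i"])
    then show "y \<in> {q}" by auto
  qed (simp add: cylinder_def)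
  also have "\<dots> \<in> sets borel" by (rule sets.countable_INT) auto
  finally show ?thesis .
qed

lemma AE_neq: "AE y in cantor_measure. y \<noteq> q"
  by (rule AE_I'[of "{q}"]) (auto simp: null_sets_def cantor.emeasure_eq_measure prob_singleton borel_singleton)

section \<open>The conjugate of the shift\<close>

text \<open>The orbit of \<open>y\<close> corresponds to the shifts of \<open>\<phi> y\<close>. Only
  positive times have to avoid \<open>q\<close>: in the application \<open>x\<close> itself is sent
  to \<open>q\<close> and must stay in the domain. At those times the condition keeps the orbit
  where \<open>\<phi>\<close> is known to invert \<open>\<psi>\<close>.\<close>

definition shift_conjugate :: "(cantor \<Rightarrow> cantor) \<Rightarrow> (cantor \<Rightarrow> cantor) \<Rightarrow> cantor \<Rightarrow> cantor \<rightharpoonup> cantor" where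
  "shift_conjugate \<phi> \<psi> q y =
    (if \<psi> (\<phi> y) = y \<and> (\<forall>k. sdrop (Suc k) (\<phi> y) \<noteq> q) then Some (\<psi> (sdrop (Suc 0) (\<phi> y))) else None)"

context
  fixes \<phi> \<psi> q
  assumes \<phi>: "preserves_measure \<phi>" and \<psi>: "preserves_measure \<psi>"
    and \<phi>\<psi>: "\<And>z. z \<noteq> q \<Longrightarrow> \<phi> (\<psi> z) = z"
    and fixed: "{y. \<psi> (\<phi> y) = y} \<in> sets borel" "AE y in cantor_measure. \<psi> (\<phi> y) = y"
begin

lemma shift_conjugate_dom:
  "dom (shift_conjugate \<phi> \<psi> q) = {y. \<psi> (\<phi> y) = y} \<inter> (\<Inter>k. \<phi> -` (sdrop (Suc k) -` (- {q})))"
  by (rule set_eqI) (simp add: shift_conjugate_def domIff)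

lemma borel_shift_conjugate_dom: "dom (shift_conjugate \<phi> \<psi> q) \<in> sets borel"
proof -
  have "- {q} \<in> sets borel" using borel_singleton[of q] by (rule borel_comp)
  then have "\<phi> -` (sdrop (Suc k) -` (- {q})) \<in> sets borel" for k
    by (intro preserves_measure_vimage[OF \<phi>] borel_vimage[OF measurable_sdrop])
  then show ?thesis unfolding shift_conjugate_dom
    by (intro sets.Int fixed(1) sets.countable_INT) auto
qed

text \<open>Points are null and shifts preserve measure, so each of the countably many conditions
  holds almost everywhere.\<close>

lemma AE_shift_conjugate_dom: "AE y in cantor_measure. y \<in> dom (shift_conjugate \<phi> \<psi> q)"
proof -
  have "AE z in cantor_measure. sdrop (Suc k) z \<noteq> q" for k
  proof (induction k)
    case 0
    show ?case by (rule preserves_measure_AE[OF preserves_measure_shift AE_neq])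
  next
    case (Suc k)
    have "sdrop (Suc (Suc k)) z = sdrop (Suc k) (sdrop (Suc 0) z)" for z by (simp add: sdrop_def)
    with preserves_measure_AE[OF preserves_measure_shift Suc] show ?case by simp
  qed
  then have "AE z in cantor_measure. \<forall>k. sdrop (Suc k) z \<noteq> q" by (simp add: AE_all_countable)
  from preserves_measure_AE[OF \<phi> this] fixed(2) show ?thesis
    by eventually_elim (auto simp: shift_conjugate_dom)
qed

text \<open>Up to the null complement of the domain, a preimage is taken under a composition of
  three measure-preserving maps. The domain is forward invariant because \<phi> of the image of
  \<open>y\<close> is the shift of \<open>\<phi> y\<close>.\<close>

lemma shift_conjugate_mpt: "measure_preserving_transformation (shift_conjugate \<phi> \<psi> q)"
  unfolding measure_preserving_transformation_def
proof (intro conjI ballI allI impI)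
  let ?T = "shift_conjugate \<phi> \<psi> q"
  fix B :: "cantor set" assume B: "B \<in> sets borel"
  let ?C = "\<phi> -` (sdrop (Suc 0) -` (\<psi> -` B))"
  have eq: "preimage ?T B = dom ?T \<inter> ?C"
    by (auto simp: preimage_def shift_conjugate_def split: if_splits)
  have 1: "\<psi> -` B \<in> sets borel" by (rule preserves_measure_vimage[OF \<psi> B])
  then have 2: "sdrop (Suc 0) -` (\<psi> -` B) \<in> sets borel" by (rule borel_vimage[OF measurable_sdrop])
  then have C: "?C \<in> sets borel" by (rule preserves_measure_vimage[OF \<phi>])
  have "cantor.prob ?C = cantor.prob B"
    using preserves_measure_prob[OF \<phi> 2] preserves_measure_prob[OF preserves_measure_shift 1]
      preserves_measure_prob[OF \<psi> B] by simp
  moreover have "cantor.prob (dom ?T \<inter> ?C) = cantor.prob ?C"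
    by (rule measure_eq_AE)
      (use AE_shift_conjugate_dom borel_shift_conjugate_dom C in \<open>auto elim!: eventually_mono\<close>)
  ultimately show "emeasure cantor_measure (preimage ?T B) = emeasure cantor_measure B"
    by (simp add: eq cantor.emeasure_eq_measure)
  show "preimage ?T B \<in> sets borel" unfolding eq using C borel_shift_conjugate_dom by simp
next
  fix y z assume "shift_conjugate \<phi> \<psi> q y = Some z"
  then have y: "\<And>k. sdrop (Suc k) (\<phi> y) \<noteq> q" and z: "z = \<psi> (sdrop (Suc 0) (\<phi> y))"
    by (auto simp: shift_conjugate_def split: if_splits)
  have "\<phi> z = sdrop (Suc 0) (\<phi> y)" using \<phi>\<psi>[OF y] z by simp
  moreover have "sdrop (Suc k) (sdrop (Suc 0) (\<phi> y)) = sdrop (Suc (Suc k)) (\<phi> y)" for k by (simp add: sdrop_def)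
  ultimately show "z \<in> dom (shift_conjugate \<phi> \<psi> q)"
    using y z by (auto simp: shift_conjugate_def dom_def)
qed

text \<open>An invariant set of the conjugate pulls back to a set that is shift-invariant up to a null set,
  hence independent of all cylinders, hence independent of itself.\<close>

lemma shift_conjugate_ergodic: "ergodic (shift_conjugate \<phi> \<psi> q)"
  unfolding ergodic_def
proof (intro ballI impI)
  let ?T = "shift_conjugate \<phi> \<psi> q" and ?S = "sdrop (Suc 0)"
  fix B :: "cantor set" assume B: "B \<in> sets borel" and inv: "preimage ?T B = B"
  define C where "C = \<psi> -` B"
  have C: "C \<in> sets borel" and probC: "cantor.prob C = cantor.prob B"
    unfolding C_def by (rule preserves_measure_vimage[OF \<psi> B], rule preserves_measure_prob[OF \<psi> B])
  have SC: "?S -` C \<in> sets borel"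
    by (rule borel_vimage[OF measurable_sdrop C])
  have "AE z in cantor_measure. z \<in> C \<longleftrightarrow> z \<in> ?S -` C"
    using preserves_measure_AE[OF \<psi> AE_shift_conjugate_dom] AE_neq[of q]
  proof eventually_elim
    case (elim z)
    then have "?T (\<psi> z) = Some (\<psi> (?S z))"
      using \<phi>\<psi>[of z] by (auto simp: shift_conjugate_def split: if_splits)
    then have "\<psi> z \<in> preimage ?T B \<longleftrightarrow> \<psi> (?S z) \<in> B" by (simp add: preimage_def)
    then show ?case by (simp add: inv C_def)
  qed
  then have CS: "cantor.prob (C \<inter> cylinder s) = cantor.prob (?S -` C \<inter> cylinder s)" for s
    by (intro measure_eq_AE) (use C SC in \<open>auto elim!: eventually_mono\<close>)
  \<comment> \<open>Each bit contributes a factor 1/2: invariance replaces \<open>C\<close> by its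
    preimage under the shift, which is independent of the first bit.\<close>
  have cyl: "cantor.prob (C \<inter> cylinder s) = cantor.prob C * cantor.prob (cylinder s)" for s
  proof (induction s)
    case Nil
    then show ?case using cantor.prob_space by simp
  next
    case (Cons b s)
    have "?S -` C \<inter> cylinder (b # s) = cylinder [b] \<inter> sdrop (length [b]) -` (C \<inter> cylinder s)"
      using cylinder_append[of "[b]" s] by auto
    then have "cantor.prob (C \<inter> cylinder (b # s)) = 1/2 * cantor.prob (C \<inter> cylinder s)"
      using prob_cylinder_Int_sdrop[of "C \<inter> cylinder s" "[b]"] C by (simp add: CS)
    with Cons show ?case by (simp add: prob_cylinder)
  qed
  have "cantor.prob (C \<inter> (\<lambda>x. x) -` C) = cantor.prob C * cantor.prob C"
    by (rule prob_Int_vimage) (use C cyl in auto)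
  then have "cantor.prob B = cantor.prob B * cantor.prob B" by (simp add: probC)
  then have "cantor.prob B = 0 \<or> cantor.prob B = 1" by auto
  then show "emeasure cantor_measure B = 0 \<or> emeasure cantor_measure B = 1"
    by (auto simp: cantor.emeasure_eq_measure)
qed

end

section \<open>Exchanges of cylinders\<close>

text \<open>The relation is kept apart from the default value, so that the inverse is the same
  construction for the converse relation with a default of its own: \<open>q\<close> in one
  direction, \<open>x\<close> in the other.\<close>

definition exch :: "(bool list \<times> bool list) set \<Rightarrow> cantor \<Rightarrow> cantor \<Rightarrow> cantor" where
  "exch G p y = (if \<exists>g\<in>G. y \<in> cylinder (fst g)
     then let g = (SOME g. g \<in> G \<and> y \<in> cylinder (fst g)) in conc (snd g) (sdrop (length (fst g)) y)
     else p)"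

definition exchange :: "(bool list \<times> bool list) set \<Rightarrow> bool" where
  "exchange G \<longleftrightarrow> (\<forall>g\<in>G. length (fst g) = length (snd g)) \<and>
     disjoint_family_on (\<lambda>g. cylinder (fst g)) G \<and> disjoint_family_on (\<lambda>g. cylinder (snd g)) G \<and>
     emeasure cantor_measure (\<Union>g\<in>G. cylinder (fst g)) = 1"

lemma exch_eq:
  assumes "exchange G" "(\<tau>, \<rho>) \<in> G" "y \<in> cylinder \<tau>"
  shows "exch G p y = conc \<rho> (sdrop (length \<tau>) y)"
proof -
  have "(SOME g. g \<in> G \<and> y \<in> cylinder (fst g)) = (\<tau>, \<rho>)"
  proof (rule some_equality)
    fix g assume "g \<in> G \<and> y \<in> cylinder (fst g)"
    with assms show "g = (\<tau>, \<rho>)"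
      unfolding exchange_def disjoint_family_on_def by (metis IntI empty_iff fst_conv)
  qed (use assms in simp)
  moreover have "\<exists>g\<in>G. y \<in> cylinder (fst g)" using assms(2,3) by force
  ultimately show ?thesis by (simp add: exch_def)
qed

lemma exch_else: "y \<notin> (\<Union>g\<in>G. cylinder (fst g)) \<Longrightarrow> exch G p y = p"
  by (simp add: exch_def)

lemma UN_converse: "(\<Union>g\<in>G\<inverse>. f (fst g)) = (\<Union>g\<in>G. f (snd g))"
  by force

lemma disjoint_family_on_converse:
  "disjoint_family_on (\<lambda>g. f (fst g)) (G\<inverse>) \<longleftrightarrow> disjoint_family_on (\<lambda>g. f (snd g)) G"
  "disjoint_family_on (\<lambda>g. f (snd g)) (G\<inverse>) \<longleftrightarrow> disjoint_family_on (\<lambda>g. f (fst g)) G"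
  unfolding disjoint_family_on_def Ball_def split_paired_All converse_iff fst_conv snd_conv prod.inject
  by blast+

text \<open>Full measure is demanded of the first column only. Partners have equal measure, so the
  disjoint union of the second column has the same countable sum.\<close>

lemma exchange_converse:
  assumes "exchange G" shows "exchange (G\<inverse>)"
proof -
  have G: "\<And>g. g \<in> G \<Longrightarrow> length (fst g) = length (snd g)" "disjoint_family_on (\<lambda>g. cylinder (fst g)) G"
      "disjoint_family_on (\<lambda>g. cylinder (snd g)) G" "emeasure cantor_measure (\<Union>g\<in>G. cylinder (fst g)) = 1"
    using assms unfolding exchange_def by auto
  have "emeasure cantor_measure (\<Union>g\<in>G. cylinder (snd g)) =
      (\<integral>\<^sup>+g. emeasure cantor_measure (cylinder (snd g)) \<partial>count_space G)"
    by (rule emeasure_UN_countable) (use G in auto)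
  also have "\<dots> = (\<integral>\<^sup>+g. emeasure cantor_measure (cylinder (fst g)) \<partial>count_space G)"
    by (rule nn_integral_cong) (simp add: emeasure_cylinder G(1))
  also have "\<dots> = emeasure cantor_measure (\<Union>g\<in>G. cylinder (fst g))"
    by (rule emeasure_UN_countable[symmetric]) (use G in auto)
  finally have "emeasure cantor_measure (\<Union>g\<in>G. cylinder (snd g)) = 1" using G(4) by simp
  moreover have "(\<Union>g\<in>G\<inverse>. cylinder (fst g)) = (\<Union>g\<in>G. cylinder (snd g))" by (rule UN_converse)
  moreover have "disjoint_family_on (\<lambda>g. cylinder (fst g)) (G\<inverse>)" "disjoint_family_on (\<lambda>g. cylinder (snd g)) (G\<inverse>)"
    using G(2,3) by (simp_all add: disjoint_family_on_converse)
  moreover have "\<forall>g\<in>G\<inverse>. length (fst g) = length (snd g)" using G(1) by fastforce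
  ultimately show ?thesis unfolding exchange_def by simp
qed

lemma exch_mem:
  assumes "exchange G" "(\<tau>, \<rho>) \<in> G" "y \<in> cylinder \<tau>"
  shows "exch G p y \<in> cylinder \<rho>"
  by (simp add: exch_eq[OF assms])

lemma exch_inverse:
  assumes G: "exchange G" and y: "y \<in> (\<Union>g\<in>G. cylinder (fst g))"
  shows "exch (G\<inverse>) p' (exch G p y) = y"
proof -
  from y obtain \<tau> \<rho> where g: "(\<tau>, \<rho>) \<in> G" "y \<in> cylinder \<tau>" by auto
  then have "exch (G\<inverse>) p' (exch G p y) = conc \<tau> (sdrop (length \<rho>) (exch G p y))"
    by (intro exch_eq exchange_converse[OF G] exch_mem[OF G]) auto
  also have "\<dots> = y" by (simp add: exch_eq[OF G g] conc_sdrop[OF g(2)])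
  finally show ?thesis .
qed

lemma exch_vimage:
  assumes G: "exchange G"
  shows "exch G p -` B = (\<Union>g\<in>G. cylinder (fst g) \<inter> sdrop (length (fst g)) -` (conc (snd g) -` B)) \<union>
    (if p \<in> B then - (\<Union>g\<in>G. cylinder (fst g)) else {})"
proof (rule set_eqI)
  fix y
  show "y \<in> exch G p -` B \<longleftrightarrow> y \<in> (\<Union>g\<in>G. cylinder (fst g) \<inter> sdrop (length (fst g)) -` (conc (snd g) -` B)) \<union>
    (if p \<in> B then - (\<Union>g\<in>G. cylinder (fst g)) else {})" (is "_ \<longleftrightarrow> y \<in> ?R")
  proof (cases "y \<in> (\<Union>g\<in>G. cylinder (fst g))")
    case True
    then obtain \<tau> \<rho> where g: "(\<tau>, \<rho>) \<in> G" "y \<in> cylinder \<tau>" by auto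
    have eq: "exch G p y = conc (snd g) (sdrop (length (fst g)) y)" if "g \<in> G" "y \<in> cylinder (fst g)" for g
      using exch_eq[OF G, of "fst g" "snd g"] that by simp
    have "y \<in> ?R \<longleftrightarrow> (\<exists>g\<in>G. y \<in> cylinder (fst g) \<and> conc (snd g) (sdrop (length (fst g)) y) \<in> B)"
      using True by auto
    also have "\<dots> \<longleftrightarrow> (\<exists>g\<in>G. y \<in> cylinder (fst g) \<and> exch G p y \<in> B)"
      using eq by auto
    also have "\<dots> \<longleftrightarrow> exch G p y \<in> B" using True by auto
    finally show ?thesis by simp
  next
    case False
    then show ?thesis by (auto simp: exch_else)
  qed
qed

text \<open>Rewriting a prefix by another of the same length and keeping the tail carries the
  measure of one cylinder to that of its partner. Summation over the pairs suffices because both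
  columns have full measure.\<close>

lemma exch_preserves_measure:
  assumes G: "exchange G" shows "preserves_measure (exch G p)"
  unfolding preserves_measure_def
proof (intro conjI ballI)
  define D where "D = (\<Union>g\<in>G. cylinder (fst g))"
  define E where "E = (\<Union>g\<in>G. cylinder (snd g))"
  define X where "X B g = cylinder (fst g) \<inter> sdrop (length (fst g)) -` (conc (snd g) -` B)" for B and g :: "bool list \<times> bool list"
  have Db: "D \<in> sets borel" "E \<in> sets borel" unfolding D_def E_def by (auto intro!: sets.countable_UN'')
  have cb: "conc \<rho> -` B \<in> sets borel" if "B \<in> sets borel" for B \<rho>
    by (rule borel_vimage[OF measurable_conc that])
  have Xb: "X B g \<in> sets borel" if "B \<in> sets borel" for B g
    unfolding X_def by (intro sets.Int borel_vimage[OF measurable_sdrop] cb that borel_cylinder)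
  have UXb: "(\<Union>g\<in>G. X B g) \<in> sets borel" if "B \<in> sets borel" for B
    by (intro sets.countable_UN'' Xb that) auto
  have vim: "exch G p -` B = (\<Union>g\<in>G. X B g) \<union> (if p \<in> B then - D else {})" for B
    unfolding X_def D_def by (rule exch_vimage[OF G])
  have vb: "exch G p -` B \<in> sets borel" if "B \<in> sets borel" for B
    unfolding vim using UXb[OF that] Db(1) by auto
  then show "exch G p \<in> borel_measurable borel"
    by (intro measurableI) (auto simp: vimage_def)
  fix B :: "cantor set" assume B: "B \<in> sets borel"
  have "emeasure cantor_measure D = 1" "emeasure cantor_measure E = 1"
    using G exchange_converse[OF G] unfolding exchange_def D_def E_def
    by (simp_all add: UN_converse)
  then have AE: "AE y in cantor_measure. y \<in> D" "AE y in cantor_measure. y \<in> E"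
    using Db by (auto intro!: cantor.AE_prob_1 simp: measure_def)
  have "emeasure cantor_measure (exch G p -` B) = emeasure cantor_measure (\<Union>g\<in>G. X B g)"
    by (rule emeasure_eq_AE) (use AE(1) vb[OF B] UXb[OF B] in \<open>auto simp: vim elim!: eventually_mono\<close>)
  also have "\<dots> = (\<integral>\<^sup>+g. emeasure cantor_measure (X B g) \<partial>count_space G)"
  proof (rule emeasure_UN_countable)
    show "disjoint_family_on (X B) G"
      using G unfolding exchange_def disjoint_family_on_def X_def by blast
  qed (use Xb[OF B] in auto)
  also have "\<dots> = (\<integral>\<^sup>+g. emeasure cantor_measure (cylinder (snd g) \<inter> B) \<partial>count_space G)"
  proof (rule nn_integral_cong)
    fix g assume "g \<in> space (count_space G)"
    then have len: "length (fst g) = length (snd g)" using G by (auto simp: exchange_def)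
    \<comment> \<open>Inside the second cylinder membership in \<open>B\<close> is a condition on
      the tail, and it is the same condition as in \<open>X B g\<close>.\<close>
    have "cylinder (snd g) \<inter> B = cylinder (snd g) \<inter> sdrop (length (snd g)) -` (conc (snd g) -` B)"
      by (auto simp: conc_sdrop)
    then show "emeasure cantor_measure (X B g) = emeasure cantor_measure (cylinder (snd g) \<inter> B)"
      by (simp add: X_def len cantor.emeasure_eq_measure prob_cylinder_Int_sdrop cb[OF B] flip: len)
        (simp add: len prob_cylinder_Int_sdrop cb[OF B])
  qed
  also have "\<dots> = emeasure cantor_measure (\<Union>g\<in>G. cylinder (snd g) \<inter> B)"
  proof (rule emeasure_UN_countable[symmetric])
    show "disjoint_family_on (\<lambda>g. cylinder (snd g) \<inter> B) G"
      using G unfolding exchange_def disjoint_family_on_def by blast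
  qed (use B in auto)
  also have "\<dots> = emeasure cantor_measure B"
  proof (rule emeasure_eq_AE)
    show "AE y in cantor_measure. y \<in> (\<Union>g\<in>G. cylinder (snd g) \<inter> B) \<longleftrightarrow> y \<in> B"
      using AE(2) by eventually_elim (auto simp: E_def)
  qed (use B in \<open>auto intro!: sets.countable_UN''\<close>)
  finally show "cantor.prob (exch G p -` B) = cantor.prob B" by (simp add: measure_def)
qed

section \<open>Splittings of one half of the space\<close>

definition cylinders :: "bool list list \<Rightarrow> cantor set" where
  "cylinders L = (\<Union>\<sigma>\<in>set L. cylinder \<sigma>)"

text \<open>The order matters: with the extension by \<open>c\<close> first, iteration from
  \<open>[[\<not> c]]\<close> produces lists in lexicographic order whose heads approach
  \<open>q\<close>.\<close>

definition children :: "bool \<Rightarrow> bool list list \<Rightarrow> bool list list" where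
  "children c L = concat (map (\<lambda>\<sigma>. [\<sigma> @ [c], \<sigma> @ [\<not> c]]) L)"

text \<open>At stage \<open>m\<close> of a splitting of \<open>cylinder [\<not> c]\<close>, the strings in \<open>N m\<close> are still undecided and
  those in \<open>M m\<close> have just been selected.\<close>

definition splitting :: "bool \<Rightarrow> (nat \<Rightarrow> bool list list) \<Rightarrow> (nat \<Rightarrow> bool list list) \<Rightarrow> bool" where
  "splitting c N M \<longleftrightarrow> N 0 = [[\<not> c]] \<and> M 0 = [] \<and>
     (\<forall>m. mset (children c (N m)) = mset (N (Suc m)) + mset (M (Suc m)))"

lemma set_children: "set (children c L) = (\<Union>\<sigma>\<in>set L. {\<sigma> @ [c], \<sigma> @ [\<not> c]})"
  by (auto simp: children_def)

lemma length_children [simp]: "length (children c L) = 2 * length L"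
  by (induction L) (auto simp: children_def)

lemma distinct_children: "distinct L \<Longrightarrow> distinct (children c L)"
  by (induction L) (auto simp: children_def)

lemma cylinders_children [simp]: "cylinders (children c L) = cylinders L"
proof -
  have "cylinder (\<sigma> @ [c]) \<union> cylinder (\<sigma> @ [\<not> c]) = cylinder \<sigma>" for \<sigma>
    unfolding cylinder_append by (auto simp: cylinder_def)
  then show ?thesis by (auto simp: cylinders_def set_children)
qed

lemma cylinder_disjoint: "length \<sigma> = length \<tau> \<Longrightarrow> \<sigma> \<noteq> \<tau> \<Longrightarrow> cylinder \<sigma> \<inter> cylinder \<tau> = {}"
  using cylinder_Int[of \<sigma> \<tau>] by simp

lemma mem_cylinders_iff:
  "(\<And>\<sigma>. \<sigma> \<in> set L \<Longrightarrow> length \<sigma> = n) \<Longrightarrow> y \<in> cylinders L \<longleftrightarrow> map y [0..<n] \<in> set L"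
  by (auto simp: cylinders_def mem_cylinder_iff)

context
  fixes c N M assumes split: "splitting c N M"
begin

lemma splitting_0: "N 0 = [[\<not> c]]" "M 0 = []"
  using split by (simp_all add: splitting_def)

lemma splitting_set: "set (N (Suc m)) \<union> set (M (Suc m)) = set (children c (N m))"
  using split unfolding splitting_def by (metis set_mset_mset set_mset_union)

lemma splitting_distinct: "distinct (N m @ M m)"
proof (induction m)
  case (Suc m)
  then have "distinct (children c (N m))" by (simp add: distinct_children)
  then show ?case
    using split unfolding splitting_def by (metis mset_append mset_eq_imp_distinct_iff)
qed (simp add: splitting_0)

lemma splitting_length_sum: "length (N (Suc m)) + length (M (Suc m)) = 2 * length (N m)"
  using split unfolding splitting_def by (metis length_children mset_append size_mset length_append)

lemma splitting_length: "\<sigma> \<in> set (N m) \<union> set (M m) \<Longrightarrow> length \<sigma> = Suc m"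
proof (induction m arbitrary: \<sigma>)
  case (Suc m)
  then show ?case unfolding splitting_set set_children by fastforce
qed (simp add: splitting_0)

lemma splitting_length_N: "\<sigma> \<in> set (N m) \<Longrightarrow> length \<sigma> = Suc m"
  and splitting_length_M: "\<sigma> \<in> set (M m) \<Longrightarrow> length \<sigma> = Suc m"
  by (auto intro: splitting_length)

lemma splitting_cylinders: "cylinders (N (Suc m)) \<union> cylinders (M (Suc m)) = cylinders (N m)"
proof -
  have "cylinders (N (Suc m)) \<union> cylinders (M (Suc m)) = cylinders (children c (N m))"
    unfolding cylinders_def by (simp flip: splitting_set)
  then show ?thesis by simp
qed

lemma splitting_cylinders_subset: "i \<le> j \<Longrightarrow> cylinders (N j) \<subseteq> cylinders (N i)"
  by (induction rule: dec_induct) (use splitting_cylinders in blast)+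

lemma splitting_M_subset: "i < j \<Longrightarrow> cylinders (M j) \<subseteq> cylinders (N i)"
  using splitting_cylinders[of "j - 1"] splitting_cylinders_subset[of i "j - 1"] by (cases j) auto

text \<open>At each stage the prefix of \<open>y\<close> is either passed on or selected, and the
  second never happens.\<close>

lemma splitting_cover:
  assumes "y \<in> cylinder [\<not> c]" "\<And>m. y \<notin> cylinders (M m)" shows "y \<in> cylinders (N m)"
proof (induction m)
  case 0
  then show ?case using assms(1) by (simp add: splitting_0 cylinders_def)
next
  case (Suc m)
  then show ?case using splitting_cylinders[of m] assms(2)[of "Suc m"] by blast
qed

lemma splitting_disjoint_NM: "cylinders (N i) \<inter> cylinders (M i) = {}"
proof -
  have "y \<in> cylinders (N i) \<longleftrightarrow> map y [0..<Suc i] \<in> set (N i)" "y \<in> cylinders (M i) \<longleftrightarrow> map y [0..<Suc i] \<in> set (M i)" for y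
    by (rule mem_cylinders_iff, rule splitting_length, simp)+
  then show ?thesis using splitting_distinct[of i] by auto
qed

lemma splitting_disjoint:
  assumes "\<sigma> \<in> set (M i)" "\<tau> \<in> set (M j)" "i \<noteq> j" shows "cylinder \<sigma> \<inter> cylinder \<tau> = {}"
proof -
  have "cylinder \<sigma> \<subseteq> cylinders (M i)" "cylinder \<tau> \<subseteq> cylinders (M j)"
    using assms by (auto simp: cylinders_def)
  moreover have "cylinders (M i) \<inter> cylinders (M j) = {}" if "i < j" for i j
    using splitting_M_subset[OF that] splitting_disjoint_NM[of i] by blast
  ultimately show ?thesis using assms(3) by (metis disjoint_iff_not_equal nat_neq_iff subset_iff)
qed

lemma splitting_M_subset_cylinder: "cylinders (M m) \<subseteq> cylinder [\<not> c]"
proof (cases m)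
  case (Suc k)
  then show ?thesis using splitting_M_subset[of 0 m] by (simp add: splitting_0 cylinders_def)
qed (simp add: splitting_0 cylinders_def)

text \<open>Undecided strings of one stage have equal length, so the measure of the undecided part
  can be read off from their number.\<close>

lemma prob_splitting: "cantor.prob (cylinders (N m)) = real (length (N m)) * (1/2) ^ Suc m"
proof -
  have "cantor.prob (\<Union>\<sigma>\<in>set (N m). cylinder \<sigma>) = (\<Sum>\<sigma>\<in>set (N m). cantor.prob (cylinder \<sigma>))"
    by (rule cantor.finite_measure_finite_Union)
      (auto simp: disjoint_family_on_def splitting_length_N intro!: cylinder_disjoint)
  also have "\<dots> = (\<Sum>\<sigma>\<in>set (N m). (1/2) ^ Suc m)"
    by (rule sum.cong) (auto simp: prob_cylinder splitting_length_N)
  also have "\<dots> = real (length (N m)) * (1/2) ^ Suc m"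
    using splitting_distinct[of m] by (simp add: distinct_card)
  finally show ?thesis by (simp add: cylinders_def)
qed

end

section \<open>Pairing two splittings\<close>

text \<open>The pair \<open>([c], [c])\<close> makes the exchange the identity on the other half, so
  \<open>c c c ...\<close> is fixed by it.\<close>

definition paired :: "bool \<Rightarrow> (nat \<Rightarrow> bool list list) \<Rightarrow> (nat \<Rightarrow> bool list list) \<Rightarrow> (bool list \<times> bool list) set" where
  "paired c M F = insert ([c], [c]) (\<Union>m. set (zip (M m) (F m)))"

text \<open>Stated for the first column; exchanging the roles of the two splittings yields the
  second.\<close>

lemma splitting_disjoint_paired:
  assumes M: "splitting c N M" and len: "\<And>m. length (M m) = length (F m)"
  shows "disjoint_family_on (\<lambda>g. cylinder (fst g)) (paired c M F)"
  unfolding disjoint_family_on_def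
proof (intro ballI impI)
  have c: "cylinder [c] \<inter> cylinder (fst g) = {}" if "g \<in> set (zip (M m) (F m))" for g m
  proof -
    have "fst g \<in> set (M m)" using that set_zip_leftD[of "fst g" "snd g"] by simp
    then have "cylinder (fst g) \<subseteq> cylinder [\<not> c]"
      using splitting_M_subset_cylinder[OF M, of m] by (auto simp: cylinders_def)
    moreover have "cylinder [c] \<inter> cylinder [\<not> c] = {}" by (rule cylinder_disjoint) auto
    ultimately show ?thesis by blast
  qed
  have c': "cylinder [c] \<inter> cylinder (fst g) = {}" if "g \<in> paired c M F" "g \<noteq> ([c], [c])" for g
    using c that unfolding paired_def by blast
  fix g h assume g: "g \<in> paired c M F" and h: "h \<in> paired c M F" and "g \<noteq> h"
  show "cylinder (fst g) \<inter> cylinder (fst h) = {}"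
  proof (cases "g = ([c], [c]) \<or> h = ([c], [c])")
    case True
    then show ?thesis using c'[of g] c'[of h] g h \<open>g \<noteq> h\<close> by (auto simp: Int_commute)
  next
    case False
    then obtain i j where ij: "g \<in> set (zip (M i) (F i))" "h \<in> set (zip (M j) (F j))"
      using g h by (auto simp: paired_def)
    then have fst: "fst g \<in> set (M i)" "fst h \<in> set (M j)"
      using set_zip_leftD[of "fst g" "snd g"] set_zip_leftD[of "fst h" "snd h"] by simp_all
    show ?thesis
    proof (cases "i = j")
      case True
      have "distinct (map fst (zip (M i) (F i)))"
        using splitting_distinct[OF M, of i] by (simp add: len)
      then have "inj_on fst (set (zip (M i) (F i)))" by (simp add: distinct_map)
      then have "fst g \<noteq> fst h" using ij True \<open>g \<noteq> h\<close> by (auto dest: inj_onD)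
      moreover have "length (fst g) = length (fst h)"
        using fst True splitting_length_M[OF M] by simp
      ultimately show ?thesis by (intro cylinder_disjoint)
    next
      case False
      then show ?thesis by (rule splitting_disjoint[OF M fst])
    qed
  qed
qed

lemma Union_paired:
  assumes len: "\<And>m. length (M m) = length (F m)"
  shows "(\<Union>g\<in>paired c M F. cylinder (fst g)) = cylinder [c] \<union> (\<Union>m. cylinders (M m))"
proof -
  have "(\<Union>g\<in>set (zip (M m) (F m)). cylinder (fst g)) = cylinders (M m)" for m
  proof -
    have "set (M m) = fst ` set (zip (M m) (F m))"
      using len[of m] by (metis map_fst_zip set_map)
    then show ?thesis by (auto simp: cylinders_def)
  qed
  then show ?thesis by (auto simp: paired_def)
qed

lemma paired_converse:
  assumes "\<And>m. length (M m) = length (F m)" shows "(paired c M F)\<inverse> = paired c F M"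
proof -
  have "(set (zip (M m) (F m)))\<inverse> = set (zip (F m) (M m))" for m
    using assms[of m] by (auto simp: set_zip)
  then show ?thesis by (auto simp: paired_def)
qed

text \<open>A point in no source cylinder is undecided at every stage, so these points form a null
  set by \<open>lim\<close>.\<close>

lemma splitting_exchange:
  assumes M: "splitting c N M" and F: "splitting c E F" and len: "\<And>m. length (M m) = length (F m)"
    and lim: "(\<lambda>m. cantor.prob (cylinders (N m))) \<longlonglongrightarrow> 0"
  shows "exchange (paired c M F)"
  unfolding exchange_def
proof (intro conjI ballI)
  fix g assume "g \<in> paired c M F"
  then consider "g = ([c], [c])" | m where "g \<in> set (zip (M m) (F m))"
    by (auto simp: paired_def)
  then show "length (fst g) = length (snd g)"
  proof cases
    case (2 m)
    then have "fst g \<in> set (M m)" "snd g \<in> set (F m)"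
      using set_zip_leftD[of "fst g" "snd g"] set_zip_rightD[of "fst g" "snd g"] by simp_all
    then show ?thesis using splitting_length_M[OF M] splitting_length_M[OF F] by simp
  qed simp
next
  show "disjoint_family_on (\<lambda>g. cylinder (fst g)) (paired c M F)"
    by (rule splitting_disjoint_paired[OF M len])
  have "disjoint_family_on (\<lambda>g. cylinder (fst g)) (paired c F M)"
    by (rule splitting_disjoint_paired[OF F len[symmetric]])
  then show "disjoint_family_on (\<lambda>g. cylinder (snd g)) (paired c M F)"
    by (simp add: disjoint_family_on_converse flip: paired_converse[OF len])
  let ?D = "cylinder [c] \<union> (\<Union>m. cylinders (M m))"
  have Db: "?D \<in> sets borel" by (auto simp: cylinders_def intro!: sets.countable_UN'')
  have "- ?D \<subseteq> cylinders (N m)" for m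
  proof
    fix y assume "y \<in> - ?D"
    then show "y \<in> cylinders (N m)"
      by (intro splitting_cover[OF M]) (auto simp: cylinder_def)
  qed
  then have "cantor.prob (- ?D) \<le> cantor.prob (cylinders (N m))" for m
    by (intro cantor.finite_measure_mono) (auto simp: cylinders_def intro!: sets.countable_UN'')
  then have "cantor.prob (- ?D) \<le> 0" using lim by (meson LIMSEQ_le_const)
  moreover have "cantor.prob (- ?D) = 1 - cantor.prob ?D"
    using cantor.prob_compl[of ?D] Db by (simp add: Compl_eq_Diff_UNIV)
  moreover have "cantor.prob ?D \<le> 1" by simp
  ultimately have "cantor.prob ?D = 1" by linarith
  then show "emeasure cantor_measure (\<Union>g\<in>paired c M F. cylinder (fst g)) = 1"
    unfolding Union_paired[OF len] by (simp add: cantor.emeasure_eq_measure)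
qed

section \<open>A transformation that avoids a cylinder\<close>

lemma map_upt_mem_cylinder [simp]: "y \<in> cylinder (map y [0..<n])"
  by (simp add: mem_cylinder_iff)

lemma map_upt_add: "map y [0..<n + m] = map y [0..<n] @ map (sdrop n y) [0..<m]"
  by (induction m) (simp_all add: sdrop_def)

lemma cylinder_take: "cylinder \<sigma> \<subseteq> cylinder (take n \<sigma>)"
  by (auto simp: cylinder_def)

lemma children_Cons: "children c (\<sigma> # L) = (\<sigma> @ [c]) # (\<sigma> @ [\<not> c]) # children c L"
  by (simp add: children_def)

lemma children_take: "children c (take k L) = take (2 * k) (children c L)"
proof (induction L arbitrary: k)
  case (Cons \<sigma> L)
  then show ?case by (cases k) (simp_all add: children_Cons children_def[of c "[]"])
qed (simp add: children_def)

lemma computable_children: "computable f \<Longrightarrow> computable (\<lambda>x. children c (f x))"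
  unfolding children_def by (intro computable_intros)

section \<open>The staged construction for a null set\<close>

text \<open>\<open>Q\<close> decides whether a prefix has already left \<open>P\<close>. The bound 2
  reflects that the construction starts from the string \<open>[\<not> c]\<close> of length 1 and
  first tests its children.\<close>

context
  fixes Q :: "bool list \<Rightarrow> bool" and x :: cantor and P :: "cantor set" and c :: bool
  assumes Q: "computable Q" and P: "P \<in> null_sets cantor_measure" and xP: "x \<in> P"
    and P_iff: "\<And>y. y \<in> P \<longleftrightarrow> (\<forall>n\<ge>2. \<not> Q (map y [0..<n]))"
    and c: "c = (\<not> x 0)"
begin

text \<open>The second list keeps as many strings as stay undecided in the first and gives up its
  end. The two lists remain equally long, so as many targets are released as sources are
  selected.\<close>

definition stages :: "nat \<Rightarrow> bool list list \<times> bool list list" where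
  "stages m = ((\<lambda>p. (filter (\<lambda>\<sigma>. \<not> Q \<sigma>) (children c (fst p)),
      take (length (filter (\<lambda>\<sigma>. \<not> Q \<sigma>) (children c (fst p)))) (children c (snd p)))) ^^ m) ([[\<not> c]], [[\<not> c]])"

definition src_rest :: "nat \<Rightarrow> bool list list" where "src_rest m = fst (stages m)"
definition tgt_rest :: "nat \<Rightarrow> bool list list" where "tgt_rest m = snd (stages m)"
definition src_new :: "nat \<Rightarrow> bool list list" where "src_new m = (if m = 0 then [] else filter Q (children c (src_rest (m - 1))))"
definition tgt_new :: "nat \<Rightarrow> bool list list" where "tgt_new m = (if m = 0 then [] else drop (length (src_rest m)) (children c (tgt_rest (m - 1))))"

lemma stages_simps:
  "src_rest 0 = [[\<not> c]]" "tgt_rest 0 = [[\<not> c]]"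
  "src_rest (Suc m) = filter (\<lambda>\<sigma>. \<not> Q \<sigma>) (children c (src_rest m))"
  "tgt_rest (Suc m) = take (length (src_rest (Suc m))) (children c (tgt_rest m))"
  by (simp_all add: src_rest_def tgt_rest_def stages_def)

lemma splitting_src_rest: "splitting c src_rest src_new"
proof -
  have "mset (filter (\<lambda>\<sigma>. \<not> Q \<sigma>) L) + mset (filter Q L) = mset L" for L
    unfolding mset_filter by (subst add.commute) (rule multiset_partition[symmetric])
  then show ?thesis by (simp add: splitting_def stages_simps(1,3) src_new_def del: mset_filter)
qed

lemma splitting_tgt_rest: "splitting c tgt_rest tgt_new"
proof -
  have "mset (take n xs) + mset (drop n xs) = mset xs" for n and xs :: "bool list list"
    by (metis append_take_drop_id mset_append)
  then show ?thesis by (simp add: splitting_def stages_simps(2,4) tgt_new_def)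
qed

lemma length_tgt_rest: "length (tgt_rest m) = length (src_rest m)"
proof (induction m)
  case (Suc m)
  then show ?case using splitting_length_sum[OF splitting_src_rest, of m] by (simp add: stages_simps(4))
qed (simp add: stages_simps)

lemma length_src_new: "length (src_new m) = length (tgt_new m)"
proof (cases m)
  case (Suc k)
  then show ?thesis
    using splitting_length_sum[OF splitting_src_rest, of k] splitting_length_sum[OF splitting_tgt_rest, of k]
    by (simp add: length_tgt_rest)
qed (simp add: src_new_def tgt_new_def)

lemma mem_cylinders_src_rest: "y \<in> cylinders (src_rest m) \<longleftrightarrow> y 0 = (\<not> c) \<and> (\<forall>n. 2 \<le> n \<and> n \<le> Suc m \<longrightarrow> \<not> Q (map y [0..<n]))"
proof -
  have "map y [0..<Suc m] \<in> set (src_rest m) \<longleftrightarrow> y 0 = (\<not> c) \<and> (\<forall>n. 2 \<le> n \<and> n \<le> Suc m \<longrightarrow> \<not> Q (map y [0..<n]))"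
  proof (induction m)
    case (Suc m)
    have "map y [0..<Suc (Suc m)] \<in> set (children c (src_rest m)) \<longleftrightarrow> map y [0..<Suc m] \<in> set (src_rest m)"
      by (auto simp: set_children)
    then have A: "map y [0..<Suc (Suc m)] \<in> set (src_rest (Suc m)) \<longleftrightarrow> map y [0..<Suc m] \<in> set (src_rest m) \<and> \<not> Q (map y [0..<Suc (Suc m)])"
      by (auto simp: stages_simps(3) simp del: upt_Suc)
    have B: "(\<forall>n. 2 \<le> n \<and> n \<le> Suc (Suc m) \<longrightarrow> R n) \<longleftrightarrow> (\<forall>n. 2 \<le> n \<and> n \<le> Suc m \<longrightarrow> R n) \<and> R (Suc (Suc m))" for R
      by (metis Suc_le_mono le_SucE le_SucI le_refl numeral_2_eq_2 zero_le)
    show ?case unfolding A Suc.IH B[of "\<lambda>n. \<not> Q (map y [0..<n])"] by blast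
  qed (auto simp: stages_simps)
  then show ?thesis
    using mem_cylinders_iff[of "src_rest m" "Suc m" y] splitting_length_N[OF splitting_src_rest] by blast
qed

lemma x_mem_cylinders_src_rest: "x \<in> cylinders (src_rest m)"
  unfolding mem_cylinders_src_rest using xP P_iff[of x] c by simp

text \<open>Continuity from above: a point that is undecided at every stage lies in the null set
  \<open>P\<close>.\<close>

lemma prob_src_rest_tendsto_0: "(\<lambda>m. cantor.prob (cylinders (src_rest m))) \<longlonglongrightarrow> 0"
proof -
  have b: "cylinders (src_rest m) \<in> sets borel" for m
    unfolding cylinders_def by (intro sets.countable_UN'') auto
  have "(\<lambda>m. cantor.prob (cylinders (src_rest m))) \<longlonglongrightarrow> cantor.prob (\<Inter>m. cylinders (src_rest m))"
    by (rule cantor.finite_Lim_measure_decseq)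
      (use b splitting_cylinders_subset[OF splitting_src_rest] in \<open>auto simp: decseq_def\<close>)
  moreover have "(\<Inter>m. cylinders (src_rest m)) \<subseteq> P"
  proof
    fix y assume "y \<in> (\<Inter>m. cylinders (src_rest m))"
    then have "y \<in> cylinders (src_rest n)" for n by simp
    then have "\<not> Q (map y [0..<n])" if "n \<ge> 2" for n
      using that mem_cylinders_src_rest[of y n] by auto
    then show "y \<in> P" unfolding P_iff by blast
  qed
  then have "cantor.prob (\<Inter>m. cylinders (src_rest m)) \<le> cantor.prob P"
    using P by (intro cantor.finite_measure_mono) auto
  moreover have "cantor.prob P = 0" using P by (simp add: measure_def null_sets_def)
  ultimately show ?thesis by (simp add: measure_le_0_iff)
qed

text \<open>The leftmost path in the order given by \<open>children\<close>. Its proper shifts are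
  all the constant sequence \<open>c\<close>, a fixed point of the shift.\<close>

definition limit_point :: cantor where "limit_point = conc [\<not> c] (\<lambda>_. c)"

lemma map_limit_point_Suc: "map limit_point [0..<Suc (Suc m)] = map limit_point [0..<Suc m] @ [c]"
  by (simp add: limit_point_def conc_def)

definition all_strings :: "nat \<Rightarrow> bool list list" where "all_strings m = (children c ^^ m) [[\<not> c]]"

lemma all_strings_simps: "all_strings 0 = [[\<not> c]]" "all_strings (Suc m) = children c (all_strings m)"
  by (simp_all add: all_strings_def)

text \<open>\<open>children\<close> maps initial segments to initial segments, so the releases of
  all stages together cut off nothing but the lexicographic end of the full level.\<close>

lemma tgt_rest_eq_take: "tgt_rest m = take (length (src_rest m)) (all_strings m)"
proof (induction m)
  case (Suc m)
  have "length (src_rest (Suc m)) \<le> 2 * length (src_rest m)"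
    using splitting_length_sum[OF splitting_src_rest, of m] by simp
  then show ?case
    unfolding stages_simps(4) Suc children_take all_strings_simps by (simp add: take_take min_def)
qed (simp add: stages_simps all_strings_simps)

lemma all_strings_Cons: "\<exists>L. all_strings m = map limit_point [0..<Suc m] # L"
proof (induction m)
  case 0
  then show ?case by (simp add: all_strings_simps limit_point_def conc_def)
next
  case (Suc m)
  then show ?case unfolding all_strings_simps map_limit_point_Suc by (auto simp: children_Cons simp del: upt_Suc)
qed

text \<open>The lists \<open>all_strings m\<close> and hence \<open>tgt_rest m\<close> are in lexicographic order (with \<open>c\<close> first), so a short \<open>tgt_rest m\<close> lies
  near \<open>limit_point\<close>.\<close>

lemma take_all_strings:
  "t \<in> set (take (2 ^ j) (all_strings (i + j))) \<Longrightarrow> take (Suc i) t = map limit_point [0..<Suc i]"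
proof (induction j arbitrary: t)
  case 0
  then show ?case using all_strings_Cons[of i] by (auto simp del: upt_Suc)
next
  case (Suc j)
  have "take (2 ^ Suc j) (all_strings (i + Suc j)) = children c (take (2 ^ j) (all_strings (i + j)))"
    by (simp add: children_take all_strings_simps)
  with Suc.prems obtain s b where s: "s \<in> set (take (2 ^ j) (all_strings (i + j)))" "t = s @ [b]"
    by (auto simp: set_children)
  then have "take (Suc i) s = map limit_point [0..<Suc i]" using Suc.IH by blast
  moreover from this have "Suc i \<le> length s"
    by (metis length_map length_upt diff_zero length_take min.cobounded1)
  ultimately show ?case by (simp add: s(2) del: upt_Suc)
qed

text \<open>A string of stage \<open>i + k\<close> has measure \<open>(1/2) ^ Suc (i + k)\<close>.
  Once the undecided part has measure below \<open>(1/2) ^ Suc i\<close>, fewer than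
  \<open>2 ^ k\<close> sources are left, hence equally few targets, and these extend the leftmost
  string of length \<open>Suc i\<close>.\<close>

lemma tgt_rest_near_limit_point: "\<exists>m. \<forall>t\<in>set (tgt_rest m). take (Suc i) t = map limit_point [0..<Suc i]"
proof -
  have "\<forall>\<^sub>F m in sequentially. cantor.prob (cylinders (src_rest m)) < (1/2) ^ Suc i"
    using prob_src_rest_tendsto_0 by (rule order_tendstoD) simp
  then obtain k where k: "\<And>m. m \<ge> k \<Longrightarrow> cantor.prob (cylinders (src_rest m)) < (1/2) ^ Suc i"
    by (auto simp: eventually_sequentially)
  have "real (length (src_rest (i + k))) * (1/2) ^ Suc (i + k) < (1/2) ^ Suc i"
    using k[of "i + k"] by (simp add: prob_splitting[OF splitting_src_rest])
  then have "real (length (src_rest (i + k))) < 2 ^ k"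
    by (simp add: power_add field_simps)
  then have "real (length (src_rest (i + k))) < real (2 ^ k)" by simp
  then have "length (src_rest (i + k)) \<le> 2 ^ k" by (simp only: of_nat_less_iff less_imp_le)
  then have "set (tgt_rest (i + k)) \<subseteq> set (take (2 ^ k) (all_strings (i + k)))"
    unfolding tgt_rest_eq_take by (rule set_take_subset_set_take)
  then show ?thesis using take_all_strings by blast
qed

text \<open>The point \<open>x\<close> is never decided, so at least one target always remains, and
  targets are kept from the left.\<close>

lemma limit_point_mem_cylinders_tgt_rest: "limit_point \<in> cylinders (tgt_rest m)"
proof -
  have "src_rest m \<noteq> []" using x_mem_cylinders_src_rest[of m] by (auto simp: cylinders_def)
  then have "map limit_point [0..<Suc m] \<in> set (tgt_rest m)"
    using all_strings_Cons[of m] unfolding tgt_rest_eq_take by (cases "length (src_rest m)") (auto simp del: upt_Suc)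
  then show ?thesis unfolding cylinders_def by (rule UN_I) (rule map_upt_mem_cylinder)
qed

section \<open>The conjugating maps and their exceptional points\<close>

abbreviation pairs where "pairs \<equiv> paired c src_new tgt_new"
abbreviation \<phi> where "\<phi> \<equiv> exch pairs limit_point"
abbreviation \<psi> where "\<psi> \<equiv> exch (pairs\<inverse>) x"
abbreviation avoider where "avoider \<equiv> shift_conjugate \<phi> \<psi> limit_point"

lemma exchange_pairs: "exchange pairs"
  by (rule splitting_exchange[OF splitting_src_rest splitting_tgt_rest length_src_new prob_src_rest_tendsto_0])

lemma Union_fst_pairs: "(\<Union>g\<in>pairs. cylinder (fst g)) = cylinder [c] \<union> (\<Union>m. cylinders (src_new m))"
  by (rule Union_paired[OF length_src_new])

lemma Union_snd_pairs: "(\<Union>g\<in>pairs. cylinder (snd g)) = cylinder [c] \<union> (\<Union>m. cylinders (tgt_new m))"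
  using Union_paired[OF length_src_new[symmetric], of c] by (simp only: UN_converse flip: paired_converse[OF length_src_new])

lemma not_fst_pairs: "y \<notin> (\<Union>g\<in>pairs. cylinder (fst g)) \<Longrightarrow> y \<in> cylinders (src_rest m)"
  unfolding Union_fst_pairs by (rule splitting_cover[OF splitting_src_rest]) (auto simp: cylinder_def)

lemma x_not_fst_pairs: "x \<notin> (\<Union>g\<in>pairs. cylinder (fst g))"
proof -
  have "x \<notin> cylinder [c]" using c by (simp add: cylinder_def)
  moreover have "x \<notin> cylinders (src_new m)" for m
    using x_mem_cylinders_src_rest[of m] splitting_disjoint_NM[OF splitting_src_rest, of m] by blast
  ultimately show ?thesis unfolding Union_fst_pairs by blast
qed

lemma limit_point_not_snd_pairs: "limit_point \<notin> (\<Union>g\<in>pairs. cylinder (snd g))"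
proof -
  have "limit_point \<notin> cylinder [c]" by (simp add: cylinder_def limit_point_def conc_def)
  moreover have "limit_point \<notin> cylinders (tgt_new m)" for m
    using limit_point_mem_cylinders_tgt_rest[of m] splitting_disjoint_NM[OF splitting_tgt_rest, of m] by blast
  ultimately show ?thesis unfolding Union_snd_pairs by blast
qed

text \<open>The sources miss every point of \<open>P\<close> in their half, whereas the targets miss
  a single point, because the strings not yet released close in on it.\<close>

lemma not_snd_pairs_imp_limit_point: assumes "z \<notin> (\<Union>g\<in>pairs. cylinder (snd g))" shows "z = limit_point"
proof
  fix i
  obtain m where m: "\<forall>t\<in>set (tgt_rest m). take (Suc i) t = map limit_point [0..<Suc i]" using tgt_rest_near_limit_point by blast
  have "z \<in> cylinders (tgt_rest m)"
    using assms unfolding Union_snd_pairs by (intro splitting_cover[OF splitting_tgt_rest]) (auto simp: cylinder_def)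
  then obtain t where "t \<in> set (tgt_rest m)" "z \<in> cylinder t" by (auto simp: cylinders_def)
  then have "z \<in> cylinder (map limit_point [0..<Suc i])" using m cylinder_take by (metis subsetD)
  then show "z i = limit_point i" by (simp add: cylinder_def del: upt_Suc)
qed

lemma \<phi>_x: "\<phi> x = limit_point"
  by (rule exch_else[OF x_not_fst_pairs])

lemma \<psi>_limit_point: "\<psi> limit_point = x"
  by (rule exch_else) (use limit_point_not_snd_pairs in \<open>simp only: UN_converse not_False_eq_True\<close>)

lemma \<phi>_\<psi>: assumes "z \<noteq> limit_point" shows "\<phi> (\<psi> z) = z"
proof -
  have "z \<in> (\<Union>g\<in>pairs\<inverse>. cylinder (fst g))"
    using assms not_snd_pairs_imp_limit_point unfolding UN_converse by blast
  from exch_inverse[OF exchange_converse[OF exchange_pairs] this] show ?thesis by simp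
qed

text \<open>All points outside the source cylinders go to \<open>limit_point\<close>, and from there
  \<psi> returns to \<open>x\<close>; of these points exactly \<open>x\<close> passes the
  test.\<close>

lemma \<psi>_\<phi>_iff: "\<psi> (\<phi> y) = y \<longleftrightarrow> y \<in> insert x (\<Union>g\<in>pairs. cylinder (fst g))"
proof (cases "y \<in> (\<Union>g\<in>pairs. cylinder (fst g))")
  case True
  then show ?thesis using exch_inverse[OF exchange_pairs True] by simp
next
  case False
  then show ?thesis using exch_else[OF False, of limit_point] \<psi>_limit_point by auto
qed

lemma fixed_borel: "{y. \<psi> (\<phi> y) = y} \<in> sets borel"
proof -
  have "{y. \<psi> (\<phi> y) = y} = {x} \<union> (\<Union>g\<in>pairs. cylinder (fst g))"
    unfolding \<psi>_\<phi>_iff by blast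
  moreover have "(\<Union>g\<in>pairs. cylinder (fst g)) \<in> sets borel" by (intro sets.countable_UN'') auto
  ultimately show ?thesis by (simp only: sets.Un borel_singleton)
qed

lemma fixed_AE: "AE y in cantor_measure. \<psi> (\<phi> y) = y"
proof -
  have "(\<Union>g\<in>pairs. cylinder (fst g)) \<in> sets borel" by (intro sets.countable_UN'') auto
  then have "AE y in cantor_measure. y \<in> (\<Union>g\<in>pairs. cylinder (fst g))"
    using exchange_pairs by (intro cantor.AE_prob_1) (simp add: exchange_def measure_def)
  then show ?thesis by eventually_elim (simp add: \<psi>_\<phi>_iff)
qed

lemmas conjugate = exch_preserves_measure[OF exchange_pairs, of limit_point]
  exch_preserves_measure[OF exchange_converse[OF exchange_pairs], of x] \<phi>_\<psi> fixed_borel fixed_AE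

text \<open>\<open>\<Phi> \<tau> \<rho>\<close> is a semidecidable witness that \<open>\<phi>\<close> maps \<open>cylinder \<tau>\<close> into \<open>cylinder \<rho>\<close>; the second disjunct provides
  arbitrarily long \<open>\<rho>\<close> for the prefixes \<open>\<tau>\<close> of \<open>x\<close>. No such disjunct is needed for \<open>\<Psi>\<close>, because the domain of
  \<open>shift_conjugate\<close> excludes the points whose shifted image is \<open>limit_point\<close>.\<close>

definition \<Phi> :: "bool list \<Rightarrow> bool list \<Rightarrow> bool" where
  "\<Phi> \<tau> \<rho> \<longleftrightarrow> (\<exists>g u. g \<in> pairs \<and> \<tau> = fst g @ u \<and> \<rho> = snd g @ u) \<or>
     (\<exists>m. \<tau> \<in> set (src_rest m) \<and> (\<forall>t\<in>set (tgt_rest m). take (length \<rho>) t = \<rho>))"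

definition \<Psi> :: "bool list \<Rightarrow> bool list \<Rightarrow> bool" where
  "\<Psi> \<rho> \<sigma> \<longleftrightarrow> (\<exists>g v. g \<in> pairs \<and> \<rho> = snd g @ v \<and> take (length \<sigma>) (fst g @ v) = \<sigma>)"

lemma exch_append:
  assumes "exchange H" "g \<in> H" "y \<in> cylinder (fst g @ u)" shows "exch H p y \<in> cylinder (snd g @ u)"
proof -
  have y: "y \<in> cylinder (fst g)" "sdrop (length (fst g)) y \<in> cylinder u"
    using assms(3) by (auto simp: cylinder_append)
  then have "exch H p y = conc (snd g) (sdrop (length (fst g)) y)"
    using exch_eq[OF assms(1), of "fst g" "snd g"] assms(2) by simp
  then show ?thesis using y(2) by (simp add: cylinder_append)
qed

text \<open>A point undecided at stage \<open>m\<close> is either paired at a later stage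
  \<open>j\<close>, with a target that was still available at stage \<open>m\<close>, or never
  paired and sent to \<open>limit_point\<close>, which is never released.\<close>

lemma \<phi>_src_rest_subset_tgt_rest: assumes "y \<in> cylinders (src_rest m)" shows "\<phi> y \<in> cylinders (tgt_rest m)"
proof (cases "y \<in> (\<Union>g\<in>pairs. cylinder (fst g))")
  case True
  then obtain g where g: "g \<in> pairs" "y \<in> cylinder (fst g)" by blast
  have "y 0 = (\<not> c)" using assms by (simp add: mem_cylinders_src_rest)
  then have "g \<noteq> ([c], [c])" using g(2) by (auto simp: cylinder_def)
  with g(1) obtain j where j: "g \<in> set (zip (src_new j) (tgt_new j))" by (auto simp: paired_def)
  then have "fst g \<in> set (src_new j)" "snd g \<in> set (tgt_new j)"
    using set_zip_leftD[of "fst g" "snd g"] set_zip_rightD[of "fst g" "snd g"] by simp_all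
  then have "y \<in> cylinders (src_new j)" "\<phi> y \<in> cylinders (tgt_new j)"
    using g exch_append[OF exchange_pairs g(1), of y "[]"] by (auto simp: cylinders_def)
  moreover from this have "m < j"
    using splitting_cylinders_subset[OF splitting_src_rest, of j m] splitting_disjoint_NM[OF splitting_src_rest, of j] assms
    by (meson disjoint_iff not_le subsetD)
  ultimately show ?thesis using splitting_M_subset[OF splitting_tgt_rest, of m j] by blast
next
  case False
  then show ?thesis using exch_else[OF False, of limit_point] limit_point_mem_cylinders_tgt_rest by simp
qed

lemma \<Phi>_sound: assumes "\<Phi> \<tau> \<rho>" "y \<in> cylinder \<tau>" shows "\<phi> y \<in> cylinder \<rho>"
  using assms(1) unfolding \<Phi>_def
proof (elim disjE exE conjE)
  fix g u assume "g \<in> pairs" "\<tau> = fst g @ u" "\<rho> = snd g @ u"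
  then show ?thesis using exch_append[OF exchange_pairs] assms(2) by blast
next
  fix m assume m: "\<tau> \<in> set (src_rest m)" "\<forall>t\<in>set (tgt_rest m). take (length \<rho>) t = \<rho>"
  then have "\<phi> y \<in> cylinders (tgt_rest m)" using assms(2) by (intro \<phi>_src_rest_subset_tgt_rest) (auto simp: cylinders_def)
  then obtain t where "t \<in> set (tgt_rest m)" "\<phi> y \<in> cylinder t" by (auto simp: cylinders_def)
  with m(2) show ?thesis using cylinder_take by (metis subsetD)
qed

lemma \<Psi>_sound: assumes "\<Psi> \<rho> \<sigma>" "z \<in> cylinder \<rho>" shows "\<psi> z \<in> cylinder \<sigma>"
proof -
  from assms(1) obtain g v where g: "g \<in> pairs" "\<rho> = snd g @ v" "take (length \<sigma>) (fst g @ v) = \<sigma>"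
    unfolding \<Psi>_def by blast
  have "\<psi> z \<in> cylinder (fst g @ v)"
    using exch_append[OF exchange_converse[OF exchange_pairs], of "(snd g, fst g)" z v x] g assms(2) by simp
  with g(3) show ?thesis using cylinder_take by (metis subsetD)
qed

text \<open>On a source cylinder a prefix exchange determines any number of output bits. Elsewhere
  the point is undecided at every stage, and a stage is chosen at which all remaining targets agree
  with \<open>limit_point\<close> far enough.\<close>

lemma \<Phi>_complete: "\<exists>k n'. n \<le> n' \<and> \<Phi> (map y [0..<k]) (map (\<phi> y) [0..<n'])"
proof (cases "y \<in> (\<Union>g\<in>pairs. cylinder (fst g))")
  case True
  then obtain g where g: "g \<in> pairs" "y \<in> cylinder (fst g)" by blast
  define u where "u = map (sdrop (length (fst g)) y) [0..<n]"
  have len: "length (fst g) = length (snd g)" using g(1) exchange_pairs by (auto simp: exchange_def)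
  have y: "map y [0..<length (fst g) + n] = fst g @ u"
    using g(2) by (simp add: map_upt_add u_def mem_cylinder_iff)
  then have "y \<in> cylinder (fst g @ u)" by (metis map_upt_mem_cylinder)
  then have "\<phi> y \<in> cylinder (snd g @ u)" by (rule exch_append[OF exchange_pairs g(1)])
  then have "map (\<phi> y) [0..<length (fst g) + n] = snd g @ u"
    by (simp add: mem_cylinder_iff len u_def)
  with y g(1) have "\<Phi> (map y [0..<length (fst g) + n]) (map (\<phi> y) [0..<length (fst g) + n])"
    unfolding \<Phi>_def by (intro disjI1 exI[of _ g] exI[of _ u]) simp
  then show ?thesis by (meson le_add2)
next
  case False
  obtain m where m: "\<forall>t\<in>set (tgt_rest m). take (Suc n) t = map limit_point [0..<Suc n]" using tgt_rest_near_limit_point by blast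
  have "map y [0..<Suc m] \<in> set (src_rest m)"
    using not_fst_pairs[OF False, of m] mem_cylinders_iff[of "src_rest m" "Suc m" y] splitting_length_N[OF splitting_src_rest] by blast
  with m have "\<Phi> (map y [0..<Suc m]) (map (\<phi> y) [0..<Suc n])"
    unfolding \<Phi>_def exch_else[OF False] by (auto simp del: upt_Suc)
  then show ?thesis by (meson le_SucI order_refl)
qed

text \<open>\<open>\<Phi>_complete\<close> controls the length of the intermediate prefix only from
  below, hence the claim for all large \<open>n'\<close>.\<close>

lemma \<Psi>_complete:
  assumes "z \<noteq> limit_point" "\<psi> z \<in> cylinder \<sigma>" shows "\<exists>n. \<forall>n'\<ge>n. \<Psi> (map z [0..<n']) \<sigma>"
proof -
  obtain g where g: "g \<in> pairs" "z \<in> cylinder (snd g)" using assms(1) not_snd_pairs_imp_limit_point by blast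
  have len: "length (fst g) = length (snd g)" using g(1) exchange_pairs by (auto simp: exchange_def)
  have "\<Psi> (map z [0..<n']) \<sigma>" if "n' \<ge> length (snd g) + length \<sigma>" for n'
  proof -
    define v where "v = map (sdrop (length (snd g)) z) [0..<n' - length (snd g)]"
    have z: "map z [0..<n'] = snd g @ v"
      using g(2) map_upt_add[of z "length (snd g)" "n' - length (snd g)"] that by (simp add: v_def mem_cylinder_iff)
    then have "z \<in> cylinder (snd g @ v)" by (metis map_upt_mem_cylinder)
    then have "\<psi> z \<in> cylinder (fst g @ v)"
      using exch_append[OF exchange_converse[OF exchange_pairs], of "(snd g, fst g)" z v x] g(1) by simp
    moreover have "length \<sigma> \<le> length (fst g @ v)" using that by (simp add: len v_def)
    ultimately have "take (length \<sigma>) (fst g @ v) = \<sigma>"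
      using cylinder_Int[of \<sigma> "fst g @ v"] assms(2) by (metis IntI empty_iff)
    with z g(1) show ?thesis unfolding \<Psi>_def by blast
  qed
  then show ?thesis by blast
qed

text \<open>The intermediate string \<rho> is a prefix of \<open>\<phi> y\<close>, and
  \<open>tl\<close> is the action of the shift on prefixes.\<close>

lemma preimage_avoider:
  "preimage avoider (cylinder \<sigma>) = dom avoider \<inter> (\<Union>\<tau>\<in>{\<tau>. \<exists>\<rho>. \<Phi> \<tau> \<rho> \<and> \<Psi> (tl \<rho>) \<sigma>}. cylinder \<tau>)"
proof (intro set_eqI iffI)
  fix y assume y: "y \<in> preimage avoider (cylinder \<sigma>)"
  then have dom: "y \<in> dom avoider" by (auto simp: preimage_def)
  let ?z = "sdrop (Suc 0) (\<phi> y)"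
  have z: "?z \<noteq> limit_point" "\<psi> ?z \<in> cylinder \<sigma>"
    using y by (auto simp: preimage_def shift_conjugate_def split: if_splits)
  obtain n where n: "\<forall>n'\<ge>n. \<Psi> (map ?z [0..<n']) \<sigma>" using \<Psi>_complete[OF z] by blast
  \<comment> \<open>\<open>Suc n\<close> bits are requested because \<open>tl\<close> removes
    one.\<close>
  obtain k n' where k: "Suc n \<le> n'" "\<Phi> (map y [0..<k]) (map (\<phi> y) [0..<n'])" using \<Phi>_complete by blast
  have "tl (map (\<phi> y) [0..<n']) = map ?z [0..<n' - 1]"
    using map_upt_add[of "\<phi> y" 1 "n' - 1"] k(1) by simp
  then have "\<Psi> (tl (map (\<phi> y) [0..<n'])) \<sigma>" using n k(1) by simp
  with k(2) dom show "y \<in> dom avoider \<inter> (\<Union>\<tau>\<in>{\<tau>. \<exists>\<rho>. \<Phi> \<tau> \<rho> \<and> \<Psi> (tl \<rho>) \<sigma>}. cylinder \<tau>)"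
    using map_upt_mem_cylinder[of y k] by blast
next
  fix y assume "y \<in> dom avoider \<inter> (\<Union>\<tau>\<in>{\<tau>. \<exists>\<rho>. \<Phi> \<tau> \<rho> \<and> \<Psi> (tl \<rho>) \<sigma>}. cylinder \<tau>)"
  then obtain \<tau> \<rho> where y: "y \<in> dom avoider" "y \<in> cylinder \<tau>" "\<Phi> \<tau> \<rho>" "\<Psi> (tl \<rho>) \<sigma>" by blast
  have "\<phi> y \<in> cylinder \<rho>" by (rule \<Phi>_sound[OF y(3,2)])
  then have "sdrop (Suc 0) (\<phi> y) \<in> cylinder (tl \<rho>)"
    by (auto simp: cylinder_def sdrop_def nth_tl)
  then have "\<psi> (sdrop (Suc 0) (\<phi> y)) \<in> cylinder \<sigma>" using \<Psi>_sound y(4) by blast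
  then show "y \<in> preimage avoider (cylinder \<sigma>)"
    using y(1) by (auto simp: preimage_def shift_conjugate_def split: if_splits)
qed

lemma computable_src_rest: "computable f \<Longrightarrow> computable (\<lambda>a. src_rest (f a))"
  and computable_tgt_rest: "computable f \<Longrightarrow> computable (\<lambda>a. tgt_rest (f a))"
  unfolding src_rest_def tgt_rest_def stages_def
  by (rule computable_funpow computable_children computable_comp[OF Q] computable_intros | assumption)+

lemma computable_src_new: "computable f \<Longrightarrow> computable (\<lambda>a. src_new (f a))"
  unfolding src_new_def
  by (rule computable_src_rest computable_children computable_comp[OF Q] computable_intros | assumption)+

lemma computable_tgt_new: "computable f \<Longrightarrow> computable (\<lambda>a. tgt_new (f a))"
  unfolding tgt_new_def
  by (rule computable_src_rest computable_tgt_rest computable_children computable_intros | assumption)+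

lemma semidec_pairs: "semidec (\<lambda>g. g \<in> pairs)"
proof -
  have "g \<in> pairs \<longleftrightarrow> g = ([c], [c]) \<or> (\<exists>m. g \<in> set (zip (src_new m) (tgt_new m)))" for g
    by (auto simp: paired_def)
  then show ?thesis
    by (simp only:) (rule semidec_disj semidec_ex semidec_computable computable_src_new computable_tgt_new computable_intros)+
qed

lemma semidec_\<Phi>: "semidec (\<lambda>p. \<Phi> (fst p) (snd p))"
  unfolding \<Phi>_def
  by (rule semidec_disj semidec_ex semidec_conj semidec_comp[OF semidec_pairs] semidec_computable
    computable_src_rest computable_tgt_rest computable_intros)+

lemma semidec_\<Psi>: "semidec (\<lambda>p. \<Psi> (fst p) (snd p))"
  unfolding \<Psi>_def
  by (rule semidec_ex semidec_conj semidec_comp[OF semidec_pairs] semidec_computable computable_intros)+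

lemma computable_avoider: "computable_transformation avoider"
  unfolding computable_transformation_def
proof (intro exI[of _ "{(\<sigma>, \<tau>). \<exists>\<rho>. \<Phi> \<tau> \<rho> \<and> \<Psi> (tl \<rho>) \<sigma>}"] conjI allI)
  have "semidec (\<lambda>p. \<exists>\<rho>. \<Phi> (snd p) \<rho> \<and> \<Psi> (tl \<rho>) (fst p))"
    by (rule semidec_ex semidec_conj semidec_comp2[OF semidec_\<Phi>] semidec_comp2[OF semidec_\<Psi>] computable_intros)+
  then show "ce_string_pairs {(\<sigma>, \<tau>). \<exists>\<rho>. \<Phi> \<tau> \<rho> \<and> \<Psi> (tl \<rho>) \<sigma>}"
    by (simp add: ce_string_pairs_iff case_prod_beta)
qed (simp add: preimage_avoider)

section \<open>The orbit of \<open>x\<close>\<close>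

lemma sdrop_limit_point: "sdrop (Suc k) limit_point = (\<lambda>_. c)"
  by (simp add: limit_point_def sdrop_def conc_def fun_eq_iff)

lemma avoider_x: "avoider x = Some (\<lambda>_. c)" and avoider_const: "avoider (\<lambda>_. c) = Some (\<lambda>_. c)"
proof -
  have pairs: "([c], [c]) \<in> pairs" "([c], [c]) \<in> pairs\<inverse>" by (auto simp: paired_def)
  have mem: "(\<lambda>_. c) \<in> cylinder [c]" by (simp add: cylinder_def)
  have "conc [c] (sdrop (length [c]) (\<lambda>_. c)) = (\<lambda>_. c)" by (rule conc_sdrop[OF mem])
  then have avoider_eq: "\<phi> (\<lambda>_. c) = (\<lambda>_. c)" "\<psi> (\<lambda>_. c) = (\<lambda>_. c)"
    by (simp_all only: exch_eq[OF exchange_pairs pairs(1) mem] exch_eq[OF exchange_converse[OF exchange_pairs] pairs(2) mem])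
  have neq: "(\<lambda>_. c) \<noteq> limit_point" by (metis conc_def length_Cons nth_Cons_0 limit_point_def zero_less_Suc)
  have "sdrop (Suc k) (\<lambda>_. c) = (\<lambda>_. c)" for k by (simp add: sdrop_def)
  then show "avoider x = Some (\<lambda>_. c)" "avoider (\<lambda>_. c) = Some (\<lambda>_. c)"
    using neq by (simp_all add: shift_conjugate_def \<phi>_x \<psi>_limit_point sdrop_limit_point avoider_eq)
qed

lemma iterate_avoider_x: "k > 0 \<Longrightarrow> iterate avoider k x = Some (\<lambda>_. c)"
proof -
  have "iterate avoider j (\<lambda>_. c) = Some (\<lambda>_. c)" for j
    by (induction j) (simp_all add: iterate_Suc avoider_const)
  then show "k > 0 \<Longrightarrow> iterate avoider k x = Some (\<lambda>_. c)"
    by (cases k) (simp_all add: iterate_Suc avoider_x)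
qed

lemma avoiding_transformation:
  "\<exists>A T. clopen A \<and> x \<in> A \<and> emeasure cantor_measure A > 0 \<and> measure_preserving_transformation T \<and>
     computable_transformation T \<and> ergodic T \<and> x \<in> dom T \<and> \<not> (\<exists>k>0. \<exists>y\<in>A. iterate T k x = Some y)"
proof (intro exI conjI)
  have "- cylinder [\<not> c] = cylinder [c]" by (auto simp: cylinder_def)
  then show "clopen (cylinder [\<not> c])"
    unfolding clopen_def closed_def by (simp add: open_cylinder)
  show "x \<in> cylinder [\<not> c]" using c by (simp add: cylinder_def)
  show "emeasure cantor_measure (cylinder [\<not> c]) > 0"
    unfolding emeasure_cylinder ennreal_less_zero_iff by simp
  show "measure_preserving_transformation avoider" by (rule shift_conjugate_mpt[OF conjugate])
  show "ergodic avoider" by (rule shift_conjugate_ergodic[OF conjugate])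
  show "computable_transformation avoider" by (rule computable_avoider)
  show "x \<in> dom avoider" using avoider_x by blast
  have "(\<lambda>_. c) \<notin> cylinder [\<not> c]" by (simp add: cylinder_def)
  then show "\<not> (\<exists>k>0. \<exists>y\<in>cylinder [\<not> c]. iterate avoider k x = Some y)" using iterate_avoider_x by auto
qed

end

lemma not_kurtz_random_avoiding:
  assumes "\<not> kurtz_random x"
  shows "\<exists>A T. clopen A \<and> x \<in> A \<and> emeasure cantor_measure A > 0 \<and> measure_preserving_transformation T \<and>
     computable_transformation T \<and> ergodic T \<and> x \<in> dom T \<and> \<not> (\<exists>k>0. \<exists>y\<in>A. iterate T k x = Some y)"
proof -
  obtain P W where P: "P \<in> null_sets cantor_measure" "x \<in> P" and "ce_strings W" and W: "- P = (\<Union>\<sigma>\<in>W. cylinder \<sigma>)"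
    using assms unfolding kurtz_random_def Pi01_def Sigma01_def by blast
  then obtain R where R: "computable R" "\<And>\<sigma>. \<sigma> \<in> W \<longleftrightarrow> (\<exists>n::nat. R (\<sigma>, n))"
    unfolding ce_strings_iff semidec_def by blast
  \<comment> \<open>Both the prefixes and the stages of the enumeration are bounded by the length of
    the string. This makes \<open>Q\<close> decidable, and it still holds for all sufficiently long
    prefixes of a point outside \<open>P\<close>.\<close>
  define Q where "Q \<tau> \<longleftrightarrow> (\<exists>i\<in>set [0..<Suc (length \<tau>)]. \<exists>s\<in>set [0..<length \<tau>]. R (take i \<tau>, s))" for \<tau>
  have "computable Q"
    unfolding Q_def
    by (rule computable_bex computable_comp[OF R(1)] computable_intros)+
  moreover have "y \<in> P \<longleftrightarrow> (\<forall>n\<ge>2. \<not> Q (map y [0..<n]))" for y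
  proof -
    have "y \<notin> P \<longleftrightarrow> (\<exists>i s. R (map y [0..<i], s))"
    proof -
      have "y \<notin> P \<longleftrightarrow> (\<exists>\<sigma>\<in>W. y \<in> cylinder \<sigma>)" using W by blast
      also have "\<dots> \<longleftrightarrow> (\<exists>i. map y [0..<i] \<in> W)"
        by (metis map_upt_mem_cylinder mem_cylinder_iff)
      finally show ?thesis by (simp add: R(2))
    qed
    also have "\<dots> \<longleftrightarrow> (\<exists>n\<ge>2. Q (map y [0..<n]))"
    proof
      assume "\<exists>i s. R (map y [0..<i], s)"
      then obtain i s where "R (map y [0..<i], s)" by blast
      \<comment> \<open>The length has to be at least \<open>i\<close>, larger than
        \<open>s\<close>, and at least 2.\<close>
      then have "Q (map y [0..<i + s + 2])"
        unfolding Q_def by (intro bexI[of _ i] bexI[of _ s]) (auto simp: take_map)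
      then show "\<exists>n\<ge>2. Q (map y [0..<n])" by (intro exI[of _ "i + s + 2"]) simp
    next
      assume "\<exists>n\<ge>2. Q (map y [0..<n])"
      then show "\<exists>i s. R (map y [0..<i], s)"
        unfolding Q_def by (auto simp: take_map)
    qed
    finally show ?thesis by blast
  qed
  ultimately show ?thesis using P by (intro avoiding_transformation[of Q P x "\<not> x 0"]) auto
qed

theorem theorem2p8:
  fixes x :: cantor
  shows
    "(kurtz_random x \<longleftrightarrow>
       (\<forall>A T. clopen A \<and> x \<in> A \<and> emeasure cantor_measure A > 0 \<and>
          measure_preserving_transformation T \<and> computable_transformation T \<and> x \<in> dom T \<longrightarrow>
          (\<exists>k>0. \<exists>y\<in>A. iterate T k x = Some y)))
     \<and>
     (kurtz_random x \<longleftrightarrow>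
       (\<forall>A T. clopen A \<and> emeasure cantor_measure A > 0 \<and>
          measure_preserving_transformation T \<and> computable_transformation T \<and> ergodic T \<and>
          x \<in> dom T \<longrightarrow>
          (\<exists>k>0. \<exists>y\<in>A. iterate T k x = Some y)))
     \<and>
     (kurtz_random x \<longleftrightarrow>
       (\<forall>A T. clopen A \<and> x \<in> A \<and> emeasure cantor_measure A > 0 \<and>
          measure_preserving_transformation T \<and> computable_transformation T \<and> ergodic T \<and>
          x \<in> dom T \<longrightarrow>
          (\<exists>k>0. \<exists>y\<in>A. iterate T k x = Some y)))"
proof -
  have forward: "\<exists>k>0. \<exists>y\<in>A. iterate T k x = Some y"
    if "kurtz_random x" "clopen A" "emeasure cantor_measure A > 0" "measure_preserving_transformation T"
      "computable_transformation T" "x \<in> dom T" "x \<in> A \<or> ergodic T" for A T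
    using kurtz_random_recurrent that by blast
  \<comment> \<open>The assumption is (d), which follows from each of (b) and (c) by restricting
    their range.\<close>
  have backward: "kurtz_random x"
    if "\<And>A T. clopen A \<Longrightarrow> x \<in> A \<Longrightarrow> emeasure cantor_measure A > 0 \<Longrightarrow>
      measure_preserving_transformation T \<Longrightarrow> computable_transformation T \<Longrightarrow> ergodic T \<Longrightarrow> x \<in> dom T \<Longrightarrow>
      \<exists>k>0. \<exists>y\<in>A. iterate T k x = Some y"
  proof (rule ccontr)
    assume "\<not> kurtz_random x"
    then obtain A T where "clopen A" "x \<in> A" "emeasure cantor_measure A > 0"
      "measure_preserving_transformation T" "computable_transformation T" "ergodic T" "x \<in> dom T"
      and "\<not> (\<exists>k>0. \<exists>y\<in>A. iterate T k x = Some y)"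
      by (blast dest: not_kurtz_random_avoiding)
    with that[of A T] show False by blast
  qed
  show ?thesis
    by (intro conjI iffI allI impI; (rule forward backward; simp)?)
qed

end
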